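(* Let $f\in\mathbb C[x_1,\dots,x_N]$ be a quasihomogeneous polynomial with an isolated singularity at the origin, $F(\mathbf x,\mathbf s)$ its unfolding, $\mathcal L\subset\mathcal H_f$ a good opposite subspace, and let $\Phi_f^\omega$ be the trivialization of the BV operator $\partial$ of $(\mathrm{PV},\bar\partial_f,\partial)$ associated with $\mathcal L$ (with good basis $\omega_1,\dots,\omega_\mu$). Then the primitive form $\zeta=\sum_{p\ge0}\zeta_{(p)}$ associated to $\mathcal L$ is found via the recursive formula for its components in the associated good basis: $$\zeta_{(p)}=-\left[\pi_{>0}\cdot(\Phi_f^\omega)^{-1}\Big(\sum_{a=1}^p\frac{(F-f)^a}{z^a\,a!}\,\zeta_{(p-a)}\Big)\right]_f,\qquad p\ge1,$$ where $[-]_f$ stands for taking the classes in $\mathrm{Jac}(f)$.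
   Context: Singularity. $f$ is quasihomogeneous: there are $q_k\in\mathbb Q\cap(0,\tfrac12]$ such that every monomial $x_1^{a_1}\cdots x_N^{a_N}$ of $f$ satisfies $\sum a_kq_k=1$, and $0$ is the only common zero of the $\partial f/\partial x_k$. $\mathrm{Jac}(f)=\mathbb C[\mathbf x]/(\partial f/\partial x_1,\dots,\partial f/\partial x_N)$, $\mu=\dim\mathrm{Jac}(f)$. Weights: $\mathrm{wt}(x_k)=q_k$, $\mathrm{wt}(z)=1$. $d^N\mathbf x=dx_1\wedge\dots\wedge dx_N$. Brieskorn lattice: $\mathcal H_f^{(0)}=\Omega^N_{\mathbb C^N}[z]/(z\,d+df\wedge)\Omega^{N-1}_{\mathbb C^N}[z]$, and $\mathcal H_f=\mathcal H^{(0)}_f\otimes_{\mathbb C[z]}\mathbb C((z^{-1}))$. Good opposite subspaces. $K_f:\mathcal H_f^{(0)}\otimes\mathcal H_f^{(0)}\to\mathbb C[z]$ is K. Saito's higher residue pairing ($K_f(za,b)=-K_f(a,zb)=zK_f(a,b)$, with $z^0$-part the residue pairing), extended to $\mathcal H_f$; $\omega_f(a,b)=\mathrm{res}_{z=0}K_f(a,b)\,dz$. A good opposite subspace is a subspace $\mathcal L\subset\mathcal H_f$ with: $\mathcal H_f=\mathcal H_f^{(0)}\oplus\mathcal L$; this decomposition is quasihomogeneous for $\mathrm{wt}$; $\omega_f(\mathcal L,\mathcal L)=0$; $z^{-1}\mathcal L\subseteq\mathcal L$. Then $B:=\mathcal H_f^{(0)}\cap z\mathcal L\cong\mathrm{Jac}(f)$,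 $\mathcal H_f^{(0)}=B[z]$, $\mathcal L=z^{-1}B[[z^{-1}]]$. A (homogeneous) basis $\omega_1,\dots,\omega_\mu$ of $B$ is called a good basis. Choose homogeneous polynomials $\phi_\alpha\in\mathbb C[\mathbf x]$ with $\omega_\alpha\equiv[\phi_\alpha d^N\mathbf x]\bmod z\mathcal H_f^{(0)}$; their classes form a basis of $\mathrm{Jac}(f)$, and one may assume $\phi_1=1$. The unfolding is $F=f+\sum_{\alpha=1}^\mu s_\alpha\phi_\alpha$. BV algebra. $\mathrm{PV}=\bigoplus_i\wedge^i\mathcal T_{\mathbb C^N}$ is the space of polyvector fields on $\mathbb C^N$ with holomorphic coefficients, with basis vectors $\theta_k=\partial/\partial x_k$; $\mathrm{PV}^0$ is the space of functions; $\partial/\partial\theta_k$ are the odd derivations dual to $\theta_k\wedge$. A holomorphic nowhere vanishing function $\lambda$ (with volume form $\frac1\lambda d^N\mathbf x$) is fixed, and $$\partial\Big(\alpha\bigwedge_{j\in J}\theta_j\Big)=\sum_k\lambda\frac{\partial}{\partial x_k}\Big(\frac{\alpha}{\lambda}\Big)\frac{\partial}{\partial\theta_k}\Big(\bigwedge_{j\in J}\theta_j\Big),\qquad\bar\partial_f=\sum_k\frac{\partial f}{\partial x_k}\frac{\partial}{\partial\theta_k}.$$ One has $H^*(\mathrm{PV},\bar\partial_f)\cong\mathrm{Jac}(f)$, $[\phi\cdot 1]\mapsto[\phi]$, and $H^*(\mathrm{PV}[z],\bar\partial_f+z\partial)\cong\mathcal H^{(0)}_f$, $[\phi\cdot1]\mapsto[\phi\,d^N\mathbf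 x]$. The trivialization $\Phi_f^\omega$ associated with the good basis is an invertible operator on $\mathrm{PV}[z]$ of the form $\mathrm{Id}+\sum_{k\ge1}z^k\Phi_k$ satisfying $\Phi_f^\omega\bar\partial_f=(\bar\partial_f+z\partial)\Phi_f^\omega$ and inducing on cohomology the map $\mathrm{Jac}(f)[z]\to\mathcal H_f^{(0)}$, $[\phi_\alpha]\mapsto\omega_\alpha$; it does not depend on $\mathbf s$, and it and its inverse are extended linearly in $z^{\pm1}$ and $\mathbf s$. Components and projections. For $\zeta=\sum_\alpha d_\alpha(\mathbf s,z)\omega_\alpha$, the component $\zeta_{(p)}=\sum_\alpha (d_\alpha)_{(p)}\omega_\alpha$, where $(d_\alpha)_{(p)}$ is the part of $d_\alpha$ of total degree $p$ in $s_1,\dots,s_\mu$. $\pi_{>0}:\mathbb C((z^{-1}))\to z\mathbb C[z]$ is the projection $\sum_{k=-\infty}^m a_kz^k\mapsto\sum_{k=1}^m a_kz^k$, applied coefficientwise. In the recursion, $(F-f)^a/(z^aa!)$ and $\zeta_{(p-a)}$ are multiplied as elements of $\mathrm{PV}^0$ (with coefficients in $z^{\pm1}$ and $\mathbf s$), $\omega_\alpha$ being represented by $\hat\omega_\alpha:=\Phi_f^\omega(\phi_\alpha)\in\mathrm{PV}^0[z]$, and the resulting class in $\mathrm{Jac}(f)$ (with coefficients in $z$, $\mathbf s$) is read in the good basis through $[\phi_\alpha]\leftrightarrow\omega_\alpha$. Primitive form. By a theorem of Li–Li–Saito there is a unique pair $(\zeta,J)$ with $\zeta\in B[z][[\mathbf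 s]]$ and $J\in[d^N\mathbf x]+z^{-1}B[[z^{-1}]][[\mathbf s]]$ such that $J=e^{(F-f)/z}(\zeta)$, where $e^{(F-f)/z}$ is the operator given by multiplying representatives by $\sum_{k\ge0}\frac{(F-f)^k}{z^kk!}$, taking classes in $\mathcal H_f$ order by order in $\mathbf s$, and expanding in the basis of $B$. The element $\zeta$ is the primitive form associated to $\mathcal L$.
   Formalization: The projection keeps the z^0 term (onto C[z], not zC[z]): as printed the formula fails for x^3+y^3+w^3. Forms and polyvector fields, and λ, have polynomial instead of holomorphic coefficients, since otherwise B[z] is not the whole lattice. Φ is taken to preserve functions. *)

theory Defs
  imports
    "HOL-Analysis.Determinants"
    "HOL-Library.Poly_Mapping"
    "HOL-Computational_Algebra.Formal_Laurent_Series"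
begin

text \<open>
  Conventions.  The variables \<open>x\<^sub>k\<close> are indexed by a finite linearly ordered type \<open>'n\<close>
  (\<open>N = CARD('n)\<close>), the basis elements \<open>\<omega>\<^sub>\<alpha>\<close>, \<open>\<phi>\<^sub>\<alpha>\<close> and the parameters \<open>s\<^sub>\<alpha>\<close> by a finite
  type \<open>'b\<close> (\<open>\<mu> = CARD('b)\<close>).  All coefficients in \<open>\<bold>x\<close> are polynomial: with entire
  coefficients \<open>\<H>\<^sub>f\<^sup>(\<^sup>0\<^sup>) = B[z]\<close> fails, already for \<open>f = x\<^sup>2\<close>.

  The field \<open>\<complex>((z\<^sup>-\<^sup>1))\<close> is \<^typ>\<open>complex fls\<close>, whose formal variable is \<open>z\<^sup>-\<^sup>1\<close>.
\<close>

type_synonym 'n cpoly = "('n \<Rightarrow>\<^sub>0 nat) \<Rightarrow>\<^sub>0 complex"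
type_synonym 'n zpoly = "('n \<Rightarrow>\<^sub>0 nat) \<Rightarrow>\<^sub>0 complex fls"


subsection \<open>The variable z\<close>

definition zcoeff :: "complex fls \<Rightarrow> int \<Rightarrow> complex" where
  "zcoeff a k = fls_nth a (- k)"

definition zpow :: "int \<Rightarrow> complex fls" where
  "zpow k = fls_X_intpow (- k)"

text \<open>\<open>\<complex>\<close>, \<open>\<complex>[z]\<close>, \<open>\<complex>[z, z\<^sup>-\<^sup>1]\<close> and \<open>z\<^sup>-\<^sup>1 \<complex>[[z\<^sup>-\<^sup>1]]\<close> as subsets of \<open>\<complex>((z\<^sup>-\<^sup>1))\<close>\<close>

definition zconst :: "complex fls set" where
  "zconst = range fls_const"

definition zpolys :: "complex fls set" where
  "zpolys = {a. \<forall>k<0. zcoeff a k = 0}"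

definition zlaurent :: "complex fls set" where
  "zlaurent = {a. finite {k. zcoeff a k \<noteq> 0}}"

definition zneg :: "complex fls set" where
  "zneg = {a. \<forall>k\<ge>0. zcoeff a k = 0}"

text \<open>
  The projection of \<open>\<complex>((z\<^sup>-\<^sup>1))\<close> onto \<open>\<complex>[z]\<close> along \<open>z\<^sup>-\<^sup>1 \<complex>[[z\<^sup>-\<^sup>1]]\<close>; read in the good basis it is the
  projection of \<open>\<H>\<^sub>f = \<H>\<^sub>f\<^sup>(\<^sup>0\<^sup>) \<oplus> \<L>\<close> onto \<open>\<H>\<^sub>f\<^sup>(\<^sup>0\<^sup>)\<close>.  Pitfall: the term \<open>z\<^sup>0\<close> must be kept.  Dropping it,
  i.e. projecting onto \<open>z\<complex>[z]\<close>, makes the recursion for the primitive form false.  For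
  \<open>f = x\<^sup>3 + y\<^sup>3 + w\<^sup>3\<close>, \<open>B\<close> spanned by the square-free monomials and \<open>s\<close> the parameter of
  \<open>xyw\<close>, one has \<open>[(xyw)\<^sup>2] = 0\<close> and \<open>[(xyw)\<^sup>3] = -z\<^sup>3/27 [1]\<close>, so the primitive form is
  \<open>(1 + s\<^sup>3/162 + \<dots>) [1]\<close> along this parameter: it is not in \<open>[1] + z B[z][[s]]\<close>.
\<close>
definition zproj :: "complex fls \<Rightarrow> complex fls" where
  "zproj a = Abs_fls (\<lambda>n. if n \<le> 0 then fls_nth a n else 0)"

definition zconj :: "complex fls \<Rightarrow> complex fls" where
  \<comment> \<open>\<open>z \<mapsto> -z\<close>\<close>
  "zconj a = Abs_fls (\<lambda>n. (if even n then 1 else - 1) * fls_nth a n)"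


subsection \<open>Polynomials in x\<close>

definition var :: "'n \<Rightarrow> 'n cpoly" where
  "var k = Poly_Mapping.single (Poly_Mapping.single k 1) 1"

definition pd :: "'n \<Rightarrow> (('n \<Rightarrow>\<^sub>0 nat) \<Rightarrow>\<^sub>0 'a::comm_semiring_1) \<Rightarrow> (('n \<Rightarrow>\<^sub>0 nat) \<Rightarrow>\<^sub>0 'a)" where
  "pd k p = (\<Sum>m\<in>Poly_Mapping.keys p.
     Poly_Mapping.single (m - Poly_Mapping.single k 1)
       (of_nat (Poly_Mapping.lookup m k) * Poly_Mapping.lookup p m))"

definition peval :: "'n::finite cpoly \<Rightarrow> complex ^ 'n \<Rightarrow> complex" where
  "peval p x = (\<Sum>m\<in>Poly_Mapping.keys p.
     Poly_Mapping.lookup p m * (\<Prod>k\<in>UNIV. (x $ k) ^ Poly_Mapping.lookup m k))"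

definition emb :: "'n cpoly \<Rightarrow> 'n zpoly" where
  "emb p = Poly_Mapping.map fls_const p"

definition zC :: "complex fls \<Rightarrow> 'n zpoly" where
  "zC c = Poly_Mapping.single 0 c"

definition coeffs_in :: "complex fls set \<Rightarrow> 'n zpoly \<Rightarrow> bool" where
  "coeffs_in A u \<longleftrightarrow> (\<forall>m. Poly_Mapping.lookup u m \<in> A)"

definition wt :: "('n::finite \<Rightarrow> rat) \<Rightarrow> ('n \<Rightarrow>\<^sub>0 nat) \<Rightarrow> rat" where
  "wt q m = (\<Sum>k\<in>UNIV. of_nat (Poly_Mapping.lookup m k) * q k)"

definition quasihomogeneous :: "('n::finite \<Rightarrow> rat) \<Rightarrow> 'n cpoly \<Rightarrow> bool" where
  "quasihomogeneous q f \<longleftrightarrow>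
     (\<forall>k. 0 < q k \<and> q k \<le> 1 / 2) \<and> (\<forall>m\<in>Poly_Mapping.keys f. wt q m = 1)"

definition isolated_singularity :: "'n::finite cpoly \<Rightarrow> bool" where
  "isolated_singularity f \<longleftrightarrow> (\<forall>x. (\<forall>k. peval (pd k f) x = 0) \<longleftrightarrow> x = 0)"

definition homogeneous :: "('n::finite \<Rightarrow> rat) \<Rightarrow> 'n cpoly \<Rightarrow> bool" where
  "homogeneous q p \<longleftrightarrow> (\<exists>r. \<forall>m\<in>Poly_Mapping.keys p. wt q m = r)"

text \<open>
  Component of weight \<open>r\<close>, with \<open>wt(z) = 1\<close>: a monomial \<open>x\<^sup>m\<close> contributes at most the power \<open>z\<^sup>k\<close>
  with \<open>k = r - wt(x\<^sup>m)\<close>.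
\<close>
definition wcomp :: "('n::finite \<Rightarrow> rat) \<Rightarrow> rat \<Rightarrow> 'n zpoly \<Rightarrow> 'n zpoly" where
  "wcomp q r u = (\<Sum>m\<in>Poly_Mapping.keys u.
     Poly_Mapping.single m
       (if r - wt q m \<in> \<int>
        then fls_const (zcoeff (Poly_Mapping.lookup u m) \<lfloor>r - wt q m\<rfloor>) * zpow \<lfloor>r - wt q m\<rfloor>
        else 0))"

definition jacobian_ideal :: "'n::finite cpoly \<Rightarrow> 'n cpoly set" where
  "jacobian_ideal f = {\<Sum>k\<in>UNIV. g k * pd k f | g. True}"

definition jac_basis :: "'n::finite cpoly \<Rightarrow> ('b::finite \<Rightarrow> 'n cpoly) \<Rightarrow> bool" where
  "jac_basis f \<phi> \<longleftrightarrow>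
     (\<forall>p. \<exists>!c. p - (\<Sum>\<alpha>\<in>UNIV. Poly_Mapping.single 0 (c \<alpha>) * \<phi> \<alpha>) \<in> jacobian_ideal f)"


subsection \<open>Differential forms and polyvector fields\<close>

text \<open>
  A family of coefficients, one for each set \<open>J\<close> of indices, stands for \<open>\<Sum>\<^sub>J v\<^sub>J dx\<^sub>J\<close> or for
  \<open>\<Sum>\<^sub>J v\<^sub>J \<theta>\<^sub>J\<close>, the factors of \<open>dx\<^sub>J\<close>, \<open>\<theta>\<^sub>J\<close> being in increasing order.
\<close>
type_synonym 'n ext = "'n set \<Rightarrow> 'n zpoly"

definition of_degree :: "nat \<Rightarrow> 'n ext \<Rightarrow> bool" where
  "of_degree i v \<longleftrightarrow> (\<forall>J. v J \<noteq> 0 \<longrightarrow> card J = i)"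

text \<open>
  For \<open>k \<notin> I\<close> and \<open>J = I \<union> {k}\<close> this is the sign in \<open>dx\<^sub>k \<and> dx\<^sub>I = \<plusminus>dx\<^sub>J\<close> and in
  \<open>\<partial>/\<partial>\<theta>\<^sub>k \<theta>\<^sub>J = \<plusminus>\<theta>\<^sub>I\<close>.
\<close>
definition ext_sign :: "'n::linorder \<Rightarrow> 'n set \<Rightarrow> 'n zpoly" where
  "ext_sign k J = (- 1) ^ card {j\<in>J. j < k}"

definition form_d :: "'n::{finite,linorder} ext \<Rightarrow> 'n ext" where
  "form_d \<eta> J = (\<Sum>k\<in>J. ext_sign k J * pd k (\<eta> (J - {k})))"

definition df_wedge :: "'n::{finite,linorder} cpoly \<Rightarrow> 'n ext \<Rightarrow> 'n ext" where
  "df_wedge f \<eta> J = (\<Sum>k\<in>J. ext_sign k J * (emb (pd k f) * \<eta> (J - {k})))"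

definition pv_dbar :: "'n::{finite,linorder} cpoly \<Rightarrow> 'n ext \<Rightarrow> 'n ext" where
  "pv_dbar f v I = (\<Sum>k\<in>- I. ext_sign k I * (emb (pd k f) * v (insert k I)))"

text \<open>
  Meant for \<open>p = \<lambda>\<close>: a nowhere vanishing polynomial is a unit of \<open>\<complex>[\<bold>x]\<close>.
\<close>
definition poly_inv :: "'n cpoly \<Rightarrow> 'n cpoly" where
  "poly_inv p = (THE g. p * g = 1)"

definition pv_div :: "'n::{finite,linorder} cpoly \<Rightarrow> 'n ext \<Rightarrow> 'n ext" where
  "pv_div lam v I =
     (\<Sum>k\<in>- I. ext_sign k I * (emb lam * pd k (v (insert k I) * emb (poly_inv lam))))"

text \<open>\<open>PV\<close>, \<open>PV[z]\<close>, \<open>PV[z, z\<^sup>-\<^sup>1]\<close> for \<open>A\<close> one of \<^const>\<open>zconst\<close>, \<^const>\<open>zpolys\<close>, \<^const>\<open>zlaurent\<close>\<close>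

definition PV :: "complex fls set \<Rightarrow> 'n ext set" where
  "PV A = {v. \<forall>J. coeffs_in A (v J)}"

definition pv_fun :: "'n zpoly \<Rightarrow> 'n ext" where
  "pv_fun g = (\<lambda>J. if J = {} then g else 0)"

definition pv_scale :: "complex fls \<Rightarrow> 'n ext \<Rightarrow> 'n ext" where
  "pv_scale c v = (\<lambda>J. zC c * v J)"

definition pv_add :: "'n ext \<Rightarrow> 'n ext \<Rightarrow> 'n ext" where
  "pv_add v w = (\<lambda>J. v J + w J)"

definition pv_zproj :: "'n ext \<Rightarrow> 'n ext" where
  "pv_zproj v = (\<lambda>J. Poly_Mapping.map zproj (v J))"


subsection \<open>The Brieskorn lattice\<close>

text \<open>
  Top degree forms are identified with their coefficient at \<open>d\<^sup>N\<bold>x\<close>.  By right exactness of the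
  tensor product, \<open>\<H>\<^sub>f = \<H>\<^sub>f\<^sup>(\<^sup>0\<^sup>) \<otimes> \<complex>((z\<^sup>-\<^sup>1))\<close> is the quotient of \<open>\<Omega>\<^sup>N \<otimes> \<complex>((z\<^sup>-\<^sup>1))\<close>, the full type
  \<^typ>\<open>'n zpoly\<close>, by the subspace \<open>brieskorn_im f\<close>.  Elements of \<open>\<H>\<^sub>f\<close> are given by
  representatives, subspaces of \<open>\<H>\<^sub>f\<close> by their preimages, i.e. by subspaces
  that contain \<open>brieskorn_im f\<close>.  In particular \<open>brieskorn0 f\<close> is the preimage of \<open>\<H>\<^sub>f\<^sup>(\<^sup>0\<^sup>)\<close>.
\<close>
definition brieskorn_im :: "'n::{finite,linorder} cpoly \<Rightarrow> 'n zpoly set" where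
  "brieskorn_im f =
     {zC (zpow 1) * form_d \<eta> UNIV + df_wedge f \<eta> UNIV | \<eta>. of_degree (CARD('n) - 1) \<eta>}"

definition brieskorn0 :: "'n::{finite,linorder} cpoly \<Rightarrow> 'n zpoly set" where
  "brieskorn0 f = {u + w | u w. coeffs_in zpolys u \<and> w \<in> brieskorn_im f}"


subsection \<open>Higher residue pairing\<close>

text \<open>
  Grothendieck residue of \<open>g dx\<^sub>1 \<and> \<dots> \<and> dx\<^sub>N / (h\<^sub>1, \<dots>, h\<^sub>N)\<close> for \<open>h\<close> whose only common zero is 0:
  if \<open>x\<^sub>i\<^sup>M\<^sup>+\<^sup>1 = \<Sum>\<^sub>j C\<^sub>i\<^sub>j h\<^sub>j\<close>, then by the transformation law it equals the residue of
  \<open>det(C) g d\<^sup>N\<bold>x / (x\<^sub>1\<^sup>M\<^sup>+\<^sup>1, \<dots>, x\<^sub>N\<^sup>M\<^sup>+\<^sup>1)\<close>, a coefficient of \<open>det(C) g\<close>.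
\<close>
definition groth_res :: "'n::finite cpoly \<Rightarrow> ('n \<Rightarrow> 'n cpoly) \<Rightarrow> complex" where
  "groth_res g h = (THE r. \<exists>M (C :: ('n cpoly) ^ 'n ^ 'n).
     (\<forall>i. var i ^ Suc M = (\<Sum>j\<in>UNIV. C $ i $ j * h j)) \<and>
     r = Poly_Mapping.lookup (g * det C) (\<Sum>i\<in>UNIV. Poly_Mapping.single i M))"

text \<open>
  A pair \<open>(a, g)\<close> stands for the rational function \<open>g / \<Prod>\<^sub>j f\<^sub>j\<^sup>a\<^sup>(\<^sup>j\<^sup>)\<close>, where \<open>f\<^sub>j = \<partial>f/\<partial>x\<^sub>j\<close>;
  \<open>frac_pd\<close> is the quotient rule over the denominator \<open>\<Prod>\<^sub>j f\<^sub>j\<^sup>a\<^sup>(\<^sup>j\<^sup>)\<^sup>+\<^sup>1\<close>.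
\<close>
type_synonym 'n jfrac = "('n \<Rightarrow> nat) \<times> 'n cpoly"

definition frac_div :: "'n \<Rightarrow> 'n jfrac \<Rightarrow> 'n jfrac" where
  "frac_div i = (\<lambda>(a, g). (a(i := Suc (a i)), g))"

definition frac_pd :: "'n::finite cpoly \<Rightarrow> 'n \<Rightarrow> 'n jfrac \<Rightarrow> 'n jfrac" where
  "frac_pd f i = (\<lambda>(a, g). (\<lambda>j. Suc (a j),
     (\<Prod>j\<in>UNIV. pd j f) * pd i g -
     g * (\<Sum>j\<in>UNIV. of_nat (a j) * pd i (pd j f) * (\<Prod>l\<in>UNIV - {j}. pd l f))))"

text \<open>
  The higher residue pairing is
  \<open>K\<^sub>f(\<phi> d\<^sup>N\<bold>x, \<psi> d\<^sup>N\<bold>x) = Res (\<phi> \<Prod>\<^sub>i (f\<^sub>i - z\<partial>\<^sub>i)\<^sup>-\<^sup>1 \<psi>)\<close> for \<open>\<phi>, \<psi> \<in> \<complex>[\<bold>x]\<close>, with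
  \<open>(f\<^sub>i - z\<partial>\<^sub>i)\<^sup>-\<^sup>1 = \<Sum>\<^sub>k z\<^sup>k (f\<^sub>i\<^sup>-\<^sup>1 \<partial>\<^sub>i)\<^sup>k f\<^sub>i\<^sup>-\<^sup>1\<close>, extended sesquilinearly.  The operators
  \<open>f\<^sub>i - z\<partial>\<^sub>i\<close> commute; integration by parts shows that the pairing vanishes as soon as one argument
  lies in \<open>brieskorn_im f\<close>.  \<open>higher_res f r\<close> is the coefficient of \<open>z\<^sup>r\<close>; by homogeneity it is
  nonzero for at most one \<open>r\<close> when \<open>\<phi>\<close> and \<open>\<psi>\<close> are monomials.
\<close>
definition resolvent_term ::
    "'n::{finite,linorder} cpoly \<Rightarrow> ('n \<Rightarrow> nat) \<Rightarrow> 'n cpoly \<Rightarrow> 'n jfrac" where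
  "resolvent_term f k \<psi> =
     foldr (\<lambda>i. ((frac_div i \<circ> frac_pd f i) ^^ k i) \<circ> frac_div i)
       (sorted_list_of_set UNIV) (\<lambda>_. 0, \<psi>)"

definition higher_res ::
    "'n::{finite,linorder} cpoly \<Rightarrow> nat \<Rightarrow> 'n cpoly \<Rightarrow> 'n cpoly \<Rightarrow> complex" where
  "higher_res f r \<phi> \<psi> = (\<Sum>k\<in>{k. (\<Sum>i\<in>UNIV. k i) = r}.
     (case resolvent_term f k \<psi> of (a, g) \<Rightarrow> groth_res (\<phi> * g) (\<lambda>j. pd j f ^ a j)))"

definition higher_res_pairing ::
    "'n::{finite,linorder} cpoly \<Rightarrow> 'n zpoly \<Rightarrow> 'n zpoly \<Rightarrow> complex fls" where
  "higher_res_pairing f u v =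
     (\<Sum>m\<in>Poly_Mapping.keys u. \<Sum>n\<in>Poly_Mapping.keys v.
        Poly_Mapping.lookup u m * zconj (Poly_Mapping.lookup v n) *
        (let K = (\<lambda>r. higher_res f r (Poly_Mapping.single m 1) (Poly_Mapping.single n 1))
         in \<Sum>r\<in>{r. K r \<noteq> 0}. fls_const (K r) * zpow (int r)))"

definition omega_pairing ::
    "'n::{finite,linorder} cpoly \<Rightarrow> 'n zpoly \<Rightarrow> 'n zpoly \<Rightarrow> complex" where
  "omega_pairing f u v = zcoeff (higher_res_pairing f u v) (- 1)"


subsection \<open>Good opposite subspaces and good bases\<close>

text \<open>
  \<open>\<L>\<close> is given by its preimage \<open>L\<close>.  As \<open>\<H>\<^sub>f\<^sup>(\<^sup>0\<^sup>)\<close> is stable under weight components,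
  the decomposition is quasihomogeneous if and only if \<open>L\<close> is stable under them.
\<close>
definition good_opposite ::
    "('n::{finite,linorder} \<Rightarrow> rat) \<Rightarrow> 'n cpoly \<Rightarrow> 'n zpoly set \<Rightarrow> bool" where
  "good_opposite q f L \<longleftrightarrow>
     brieskorn_im f \<subseteq> L \<and>
     (\<forall>u\<in>L. \<forall>v\<in>L. u + v \<in> L) \<and> (\<forall>c. \<forall>u\<in>L. zC (fls_const c) * u \<in> L) \<and>
     (\<forall>u. \<exists>v\<in>brieskorn0 f. \<exists>l\<in>L. u = v + l) \<and> brieskorn0 f \<inter> L = brieskorn_im f \<and>
     (\<forall>r. \<forall>u\<in>L. wcomp q r u \<in> L) \<and>
     (\<forall>u\<in>L. \<forall>v\<in>L. omega_pairing f u v = 0) \<and>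
     (\<forall>u\<in>L. zC (zpow (- 1)) * u \<in> L)"

definition opposite_B :: "'n::{finite,linorder} cpoly \<Rightarrow> 'n zpoly set \<Rightarrow> 'n zpoly set" where
  "opposite_B f L = {u \<in> brieskorn0 f. \<exists>l\<in>L. u = zC (zpow 1) * l}"

definition good_basis ::
    "('n::{finite,linorder} \<Rightarrow> rat) \<Rightarrow> 'n cpoly \<Rightarrow> 'n zpoly set \<Rightarrow> ('b::finite \<Rightarrow> 'n zpoly) \<Rightarrow> bool"
  where
  "good_basis q f L \<omega> \<longleftrightarrow>
     (\<forall>\<alpha>. \<omega> \<alpha> \<in> opposite_B f L) \<and>
     (\<forall>\<alpha>. \<exists>r. \<omega> \<alpha> - wcomp q r (\<omega> \<alpha>) \<in> brieskorn_im f) \<and>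
     (\<forall>u\<in>opposite_B f L. \<exists>!c. u - (\<Sum>\<alpha>\<in>UNIV. zC (fls_const (c \<alpha>)) * \<omega> \<alpha>) \<in> brieskorn_im f)"

definition leading_polys ::
    "('n::{finite,linorder} \<Rightarrow> rat) \<Rightarrow> 'n cpoly \<Rightarrow> ('b::finite \<Rightarrow> 'n zpoly) \<Rightarrow> ('b \<Rightarrow> 'n cpoly) \<Rightarrow> bool"
  where
  "leading_polys q f \<omega> \<phi> \<longleftrightarrow>
     (\<forall>\<alpha>. homogeneous q (\<phi> \<alpha>)) \<and>
     (\<forall>\<alpha>. \<exists>u\<in>brieskorn0 f. \<omega> \<alpha> - emb (\<phi> \<alpha>) - zC (zpow 1) * u \<in> brieskorn_im f) \<and>
     jac_basis f \<phi>"


subsection \<open>Trivialization\<close>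

text \<open>
  \<open>\<Phi>\<close> is the operator on \<open>PV[z]\<close> together with its unique extension to a
  \<open>\<complex>[z, z\<^sup>-\<^sup>1]\<close>-linear operator on \<open>PV[z, z\<^sup>-\<^sup>1]\<close>.  A \<open>\<complex>[z]\<close>-linear operator on \<open>PV[z]\<close> has
  the form \<open>Id + \<Sum>\<^sub>k\<^sub>\<ge>\<^sub>1 z\<^sup>k \<Phi>\<^sub>k\<close> if and only if \<open>\<Phi> v - v \<in> z PV[z]\<close> for all \<open>v \<in> PV\<close>.  The cohomology
  class of a function \<open>g\<close> in \<open>PV[z]\<close> corresponds to \<open>[g d\<^sup>N\<bold>x]\<close> in \<open>\<H>\<^sub>f\<^sup>(\<^sup>0\<^sup>)\<close>.
\<close>
definition is_trivialization ::
    "'n::{finite,linorder} cpoly \<Rightarrow> 'n cpoly \<Rightarrow> ('b::finite \<Rightarrow> 'n zpoly) \<Rightarrow> ('b \<Rightarrow> 'n cpoly) \<Rightarrow>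
     ('n ext \<Rightarrow> 'n ext) \<Rightarrow> bool" where
  "is_trivialization f lam \<omega> \<phi> \<Phi> \<longleftrightarrow>
     (\<forall>v\<in>PV zlaurent. \<Phi> v \<in> PV zlaurent) \<and>
     (\<forall>v\<in>PV zlaurent. \<forall>w\<in>PV zlaurent. \<Phi> (pv_add v w) = pv_add (\<Phi> v) (\<Phi> w)) \<and>
     (\<forall>c\<in>zlaurent. \<forall>v\<in>PV zlaurent. \<Phi> (pv_scale c v) = pv_scale c (\<Phi> v)) \<and>
     bij_betw \<Phi> (PV zpolys) (PV zpolys) \<and>
     (\<forall>v\<in>PV zconst. \<exists>w\<in>PV zpolys. \<Phi> v = pv_add v (pv_scale (zpow 1) w)) \<and>
     (\<forall>v\<in>PV zpolys.
        \<Phi> (pv_dbar f v) = pv_add (pv_dbar f (\<Phi> v)) (pv_scale (zpow 1) (pv_div lam (\<Phi> v)))) \<and>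
     (\<forall>v\<in>PV zpolys. of_degree 0 v \<longrightarrow> of_degree 0 (\<Phi> v)) \<and>
     (\<forall>\<alpha>. \<Phi> (pv_fun (emb (\<phi> \<alpha>))) {} - \<omega> \<alpha> \<in> brieskorn_im f)"

text \<open>\<open>\<omega>\<^sub>\<alpha>\<close> represented by \<open>\<Phi>(\<phi>\<^sub>\<alpha>) \<in> PV\<^sup>0[z]\<close>\<close>

definition omega_hat :: "('n ext \<Rightarrow> 'n ext) \<Rightarrow> ('b \<Rightarrow> 'n cpoly) \<Rightarrow> 'b \<Rightarrow> 'n zpoly" where
  "omega_hat \<Phi> \<phi> \<alpha> = \<Phi> (pv_fun (emb (\<phi> \<alpha>))) {}"

text \<open>
  The class of a \<open>pv_dbar f\<close>-closed polyvector field in \<open>H(PV, pv_dbar f) = Jac(f)\<close>, with coefficients in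
  \<open>\<complex>[z, z\<^sup>-\<^sup>1]\<close>, given by its coordinates in the basis \<open>[\<phi>\<^sub>\<alpha>]\<close>.
\<close>
definition jac_class ::
    "'n::{finite,linorder} cpoly \<Rightarrow> ('b::finite \<Rightarrow> 'n cpoly) \<Rightarrow> 'n ext \<Rightarrow> 'b \<Rightarrow> complex fls" where
  "jac_class f \<phi> v = (THE c. (\<forall>\<alpha>. c \<alpha> \<in> zlaurent) \<and>
     (\<exists>\<eta>\<in>PV zlaurent. v = pv_add (pv_fun (\<Sum>\<alpha>\<in>UNIV. zC (c \<alpha>) * emb (\<phi> \<alpha>))) (pv_dbar f \<eta>)))"


subsection \<open>Unfolding and primitive form\<close>

text \<open>
  Polynomials in \<open>s\<close> are polynomial mappings, power series in \<open>s\<close> are functions on exponents.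
\<close>
definition sdeg :: "('b::finite \<Rightarrow>\<^sub>0 nat) \<Rightarrow> nat" where
  "sdeg t = (\<Sum>\<alpha>\<in>UNIV. Poly_Mapping.lookup t \<alpha>)"

definition unfold_poly ::
    "'n cpoly \<Rightarrow> ('b::finite \<Rightarrow> 'n cpoly) \<Rightarrow> (('b \<Rightarrow>\<^sub>0 nat) \<Rightarrow>\<^sub>0 'n zpoly)" where
  "unfold_poly f \<phi> = Poly_Mapping.single 0 (emb f) +
     (\<Sum>\<alpha>\<in>UNIV. Poly_Mapping.single (Poly_Mapping.single \<alpha> 1) (emb (\<phi> \<alpha>)))"

definition unfold_diff ::
    "'n cpoly \<Rightarrow> ('b::finite \<Rightarrow> 'n cpoly) \<Rightarrow> (('b \<Rightarrow>\<^sub>0 nat) \<Rightarrow>\<^sub>0 'n zpoly)" where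
  "unfold_diff f \<phi> = unfold_poly f \<phi> - Poly_Mapping.single 0 (emb f)"

text \<open>
  Multiplication of a series in \<open>s\<close> by \<open>\<Sum>\<^sub>k (F - f)\<^sup>k / (z\<^sup>k k!)\<close>.  Terms with \<open>k > sdeg t\<close> do
  not contribute at \<open>s\<^sup>t\<close>, as \<open>(F - f)\<^sup>k\<close> is of degree \<open>k\<close> in \<open>s\<close>.
\<close>
definition exp_unfold ::
    "'n cpoly \<Rightarrow> ('b::finite \<Rightarrow> 'n cpoly) \<Rightarrow> (('b \<Rightarrow>\<^sub>0 nat) \<Rightarrow> 'n zpoly) \<Rightarrow> (('b \<Rightarrow>\<^sub>0 nat) \<Rightarrow> 'n zpoly)"
  where
  "exp_unfold f \<phi> S t = (\<Sum>k\<le>sdeg t. \<Sum>(t1, t2)\<in>{(t1, t2). t1 + t2 = t}.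
     zC (fls_const (1 / fact k) * zpow (- int k)) *
     Poly_Mapping.lookup (unfold_diff f \<phi> ^ k) t1 * S t2)"

text \<open>
  \<open>\<zeta> \<alpha> \<in> \<complex>[z][[s]]\<close> is the coordinate of the primitive form at \<open>\<omega>\<^sub>\<alpha>\<close>.  Multiplication by functions
  does not descend to \<open>\<H>\<^sub>f\<close>, so \<open>e\<^sup>(\<^sup>F\<^sup>-\<^sup>f\<^sup>)\<^sup>/\<^sup>z(\<zeta>)\<close> depends on the functions \<open>rep \<alpha>\<close> chosen as
  representatives of \<open>\<omega>\<^sub>\<alpha>\<close>.  The clause for \<open>t\<close> says that the coefficient of
  \<open>J = e\<^sup>(\<^sup>F\<^sup>-\<^sup>f\<^sup>)\<^sup>/\<^sup>z(\<zeta>)\<close> at \<open>s\<^sup>t\<close> is as in \<open>J \<in> [d\<^sup>N\<bold>x] + z\<^sup>-\<^sup>1 B[[z\<^sup>-\<^sup>1]][[s]]\<close>.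
\<close>
definition is_primitive_form ::
    "'n::{finite,linorder} cpoly \<Rightarrow> ('b::finite \<Rightarrow> 'n zpoly) \<Rightarrow> ('b \<Rightarrow> 'n cpoly) \<Rightarrow> ('b \<Rightarrow> 'n zpoly) \<Rightarrow>
     ('b \<Rightarrow> ('b \<Rightarrow>\<^sub>0 nat) \<Rightarrow> complex fls) \<Rightarrow> bool" where
  "is_primitive_form f \<omega> \<phi> rep \<zeta> \<longleftrightarrow>
     (\<forall>\<alpha> t. \<zeta> \<alpha> t \<in> zpolys) \<and>
     (\<forall>t. \<exists>j. (\<forall>\<alpha>. j \<alpha> \<in> zneg) \<and>
        exp_unfold f \<phi> (\<lambda>t'. \<Sum>\<alpha>\<in>UNIV. zC (\<zeta> \<alpha> t') * rep \<alpha>) t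
          - ((if t = 0 then 1 else 0) + (\<Sum>\<alpha>\<in>UNIV. zC (j \<alpha>) * \<omega> \<alpha>)) \<in> brieskorn_im f)"

definition spart :: "nat \<Rightarrow> (('b::finite \<Rightarrow>\<^sub>0 nat) \<Rightarrow> complex fls) \<Rightarrow> (('b \<Rightarrow>\<^sub>0 nat) \<Rightarrow>\<^sub>0 complex fls)"
  where
  "spart p d = Poly_Mapping.Abs_poly_mapping (\<lambda>t. if sdeg t = p then d t else 0)"

definition zeta_part ::
    "('b::finite \<Rightarrow> 'n zpoly) \<Rightarrow> ('b \<Rightarrow> ('b \<Rightarrow>\<^sub>0 nat) \<Rightarrow> complex fls) \<Rightarrow> nat \<Rightarrow>
     (('b \<Rightarrow>\<^sub>0 nat) \<Rightarrow>\<^sub>0 'n zpoly)" where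
  "zeta_part rep \<zeta> p = (\<Sum>\<alpha>\<in>UNIV.
     Poly_Mapping.map zC (spart p (\<zeta> \<alpha>)) * Poly_Mapping.single 0 (rep \<alpha>))"

definition recursion_sum ::
    "'n cpoly \<Rightarrow> ('b::finite \<Rightarrow> 'n cpoly) \<Rightarrow> ('b \<Rightarrow> 'n zpoly) \<Rightarrow>
     ('b \<Rightarrow> ('b \<Rightarrow>\<^sub>0 nat) \<Rightarrow> complex fls) \<Rightarrow> nat \<Rightarrow> (('b \<Rightarrow>\<^sub>0 nat) \<Rightarrow>\<^sub>0 'n zpoly)" where
  "recursion_sum f \<phi> rep \<zeta> p = (\<Sum>a = 1..p.
     Poly_Mapping.single 0 (zC (fls_const (1 / fact a) * zpow (- int a))) *
     unfold_diff f \<phi> ^ a * zeta_part rep \<zeta> (p - a))"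

end

theory Submission
  imports Defs "HOL-Computational_Algebra.Fundamental_Theorem_Algebra"
begin

text \<open>
  At a monomial \<open>s\<^sup>t\<close> of degree \<open>p \<ge> 1\<close>, the equation \<open>J = e\<^sup>(\<^sup>F\<^sup>-\<^sup>f\<^sup>)\<^sup>/\<^sup>z(\<zeta>)\<close> reads
  \<open>\<zeta>\<^sub>t + [G\<^sub>t] = J\<^sub>t\<close>, where \<open>G\<close> is the sum inside the recursion, \<open>\<zeta>\<^sub>t\<close> has coordinates in \<open>\<complex>[z]\<close>
  and \<open>J\<^sub>t\<close> has coordinates in \<open>z\<^sup>-\<^sup>1\<complex>[[z\<^sup>-\<^sup>1]]\<close>.  So \<open>-\<zeta>\<^sub>t\<close> is the projection of the coordinates of
  \<open>[G\<^sub>t]\<close> in the good basis to \<open>\<complex>[z]\<close>.  On the other hand, \<open>\<Phi>\<close> carries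
  \<open>\<Phi>\<^sup>-\<^sup>1(G\<^sub>t) = \<Sum> c\<^sub>\<alpha> \<phi>\<^sub>\<alpha> + (exact)\<close> to \<open>G\<^sub>t = \<Sum> c\<^sub>\<alpha> \<omega>\<^sub>\<alpha> + (exact)\<close>, hence these coordinates are
  the \<open>c\<^sub>\<alpha>\<close>, because the \<open>\<omega>\<^sub>\<alpha>\<close> are independent over \<open>\<complex>((z\<^sup>-\<^sup>1))\<close>.
\<close>


subsection \<open>Coefficients of Laurent series in 1/z\<close>

lemma fls_eq_zcoeffI: "(\<And>k. zcoeff a k = zcoeff b k) \<Longrightarrow> a = b"
  by (rule fls_eqI) (metis zcoeff_def minus_minus)

lemma zcoeff_0 [simp]: "zcoeff 0 k = 0"
  by (simp add: zcoeff_def)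

lemma zcoeff_add [simp]: "zcoeff (a + b) k = zcoeff a k + zcoeff b k"
  by (simp add: zcoeff_def)

lemma zcoeff_diff [simp]: "zcoeff (a - b) k = zcoeff a k - zcoeff b k"
  by (simp add: zcoeff_def)

lemma zcoeff_sum [simp]: "zcoeff (sum g A) k = (\<Sum>x\<in>A. zcoeff (g x) k)"
  by (induction A rule: infinite_finite_induct) auto

lemma zcoeff_const [simp]: "zcoeff (fls_const c) k = (if k = 0 then c else 0)"
  by (simp add: zcoeff_def)

lemma zcoeff_const_mult [simp]:
  "zcoeff (fls_const c * a) k = c * zcoeff a k"
  "zcoeff (a * fls_const c) k = c * zcoeff a k"
  by (simp_all add: zcoeff_def)

lemma zcoeff_zpow_mult [simp]:
  "zcoeff (zpow i * a) k = zcoeff a (k - i)"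
  "zcoeff (a * zpow i) k = zcoeff a (k - i)"
  by (simp_all add: zcoeff_def zpow_def fls_shifted_times_simps algebra_simps)

lemma zcoeff_zpow: "zcoeff (zpow i) k = (if k = i then 1 else 0)"
  using zcoeff_zpow_mult(1)[of i 1 k] by (auto simp: zcoeff_def)

lemma zpow_0 [simp]: "zpow 0 = 1"
  by (rule fls_eq_zcoeffI) (simp add: zcoeff_zpow, simp add: zcoeff_def)

lemma zpow_mult: "zpow i * zpow j = zpow (i + j)"
  by (rule fls_eq_zcoeffI) (simp add: zcoeff_zpow algebra_simps eq_diff_eq)

lemma zpow_mult_left: "zpow i * (zpow j * a) = zpow (i + j) * a"
  by (simp add: zpow_mult flip: mult.assoc)

lemma zcoeff_zproj [simp]: "zcoeff (zproj a) k = (if 0 \<le> k then zcoeff a k else 0)"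
proof -
  have "\<forall>n<fls_subdegree a. (if n \<le> 0 then fls_nth a n else 0) = 0"
    by simp
  then have "fls_nth (zproj a) n = (if n \<le> 0 then fls_nth a n else 0)" for n
    unfolding zproj_def by (rule nth_Abs_fls_lower_bound)
  then show ?thesis
    by (simp add: zcoeff_def)
qed

lemma zproj_0 [simp]: "zproj 0 = 0"
  and zproj_add: "zproj (a + b) = zproj a + zproj b"
  and zproj_diff: "zproj (a - b) = zproj a - zproj b"
  and zproj_const_mult: "zproj (fls_const c * a) = fls_const c * zproj a"
  by (rule fls_eq_zcoeffI; simp)+

lemma zproj_zpolys: "a \<in> zpolys \<Longrightarrow> zproj a = a"
  by (rule fls_eq_zcoeffI) (auto simp: zpolys_def)

lemma zproj_zneg: "a \<in> zneg \<Longrightarrow> zproj a = 0"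
  by (rule fls_eq_zcoeffI) (auto simp: zneg_def)

text \<open>A Laurent series in \<open>1/z\<close> has a highest power of \<open>z\<close>, at most
  \<open>- fls_subdegree a\<close>; without negative powers only finitely many exponents
  remain.\<close>

lemma zpolys_subset_zlaurent: "zpolys \<subseteq> zlaurent"
proof
  fix a assume "a \<in> zpolys"
  then have "0 \<le> k \<and> k \<le> - fls_subdegree a" if "zcoeff a k \<noteq> 0" for k
    using that fls_eq0_below_subdegree[of "- k" a]
    by (cases "- k < fls_subdegree a"; cases "k < 0") (auto simp: zpolys_def zcoeff_def)
  then have "{k. zcoeff a k \<noteq> 0} \<subseteq> {0..- fls_subdegree a}"
    by auto
  then show "a \<in> zlaurent"
    unfolding zlaurent_def using finite_subset by blast
qed

lemma zlaurent_0 [simp]: "0 \<in> zlaurent"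
  by (simp add: zlaurent_def)

lemma zlaurent_add: "a \<in> zlaurent \<Longrightarrow> b \<in> zlaurent \<Longrightarrow> a + b \<in> zlaurent"
  unfolding zlaurent_def mem_Collect_eq
  by (rule finite_subset[where B = "{k. zcoeff a k \<noteq> 0} \<union> {k. zcoeff b k \<noteq> 0}"]) auto

lemma zlaurent_sum: "(\<And>x. x \<in> A \<Longrightarrow> g x \<in> zlaurent) \<Longrightarrow> sum g A \<in> zlaurent"
  by (induction A rule: infinite_finite_induct) (auto intro: zlaurent_add)

lemma zlaurent_const_mult: "a \<in> zlaurent \<Longrightarrow> fls_const c * a \<in> zlaurent"
  unfolding zlaurent_def mem_Collect_eq
  by (rule finite_subset[where B = "{k. zcoeff a k \<noteq> 0}"]) auto

lemma zlaurent_zpow_mult: "a \<in> zlaurent \<Longrightarrow> zpow i * a \<in> zlaurent"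
  unfolding zlaurent_def mem_Collect_eq
  by (rule finite_subset[where B = "(+) i ` {k. zcoeff a k \<noteq> 0}"])
    (auto intro!: image_eqI[where x = "_ - i"])

lemma zlaurent_const: "fls_const c \<in> zlaurent"
  by (auto simp: zlaurent_def intro: finite_subset[where B = "{0}"])

lemma zlaurent_zpow: "zpow i \<in> zlaurent"
  using zlaurent_zpow_mult[OF zlaurent_const, of i 1] by simp

lemma finite_zcoeff_expansion:
  assumes "finite K" and "\<And>k. k \<notin> K \<Longrightarrow> zcoeff a k = 0"
  shows "a = (\<Sum>k\<in>K. fls_const (zcoeff a k) * zpow k)"
  by (rule fls_eq_zcoeffI) (use assms in \<open>auto simp: zcoeff_zpow if_distrib cong: if_cong\<close>)

text \<open>Expanding one factor into finitely many terms \<open>c z^k\<close> turns the product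
  into a finite sum of scaled shifts of the other factor.\<close>

lemma zlaurent_mult:
  assumes "a \<in> zlaurent" and "b \<in> zlaurent"
  shows "a * b \<in> zlaurent"
proof -
  let ?K = "{k. zcoeff a k \<noteq> 0}"
  have "a = (\<Sum>k\<in>?K. fls_const (zcoeff a k) * zpow k)"
    using assms(1) by (intro finite_zcoeff_expansion) (auto simp: zlaurent_def)
  then have "a * b = (\<Sum>k\<in>?K. fls_const (zcoeff a k) * (zpow k * b))"
    by (metis (no_types, lifting) mult.assoc sum.cong sum_distrib_right)
  then show ?thesis
    using assms(2) by (auto intro!: zlaurent_sum zlaurent_const_mult zlaurent_zpow_mult)
qed


subsection \<open>Polynomials\<close>

lemma poly_mapping_sum_single: "p = (\<Sum>m\<in>Poly_Mapping.keys p. Poly_Mapping.single m (Poly_Mapping.lookup p m))"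
  by (rule poly_mapping_eqI)
    (auto simp: lookup_sum lookup_single when_def in_keys_iff sum.delta)

lemma poly_mapping_additive_induct [case_names zero single add]:
  fixes p :: "'m \<Rightarrow>\<^sub>0 'a::comm_monoid_add"
  assumes "P 0" and "\<And>m c. P (Poly_Mapping.single m c)" and "\<And>p q. P p \<Longrightarrow> P q \<Longrightarrow> P (p + q)"
  shows "P p"
proof -
  have "P (\<Sum>m\<in>A. Poly_Mapping.single m (Poly_Mapping.lookup p m))" if "finite A" for A
    using that by induction (auto intro: assms)
  then show ?thesis
    by (metis poly_mapping_sum_single finite_keys)
qed

lemma lookup_map: "h 0 = 0 \<Longrightarrow> Poly_Mapping.lookup (Poly_Mapping.map h p) m = h (Poly_Mapping.lookup p m)"
  by (simp add: map.rep_eq when_def)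

lemma map_0: "h 0 = 0 \<Longrightarrow> Poly_Mapping.map h 0 = 0"
  by (rule poly_mapping_eqI) (simp add: lookup_map)

lemma map_add:
  assumes "h 0 = 0" and "\<And>a b. h (a + b) = h a + h b"
  shows "Poly_Mapping.map h (p + q) = Poly_Mapping.map h p + Poly_Mapping.map h q"
  by (rule poly_mapping_eqI) (simp add: lookup_map lookup_add assms)

lemma map_sum:
  assumes "h 0 = 0" and "\<And>a b. h (a + b) = h a + h b"
  shows "Poly_Mapping.map h (sum g A) = (\<Sum>x\<in>A. Poly_Mapping.map h (g x))"
  by (induction A rule: infinite_finite_induct) (auto simp: map_0 map_add assms)

text \<open>Meant for coefficientwise maps \<open>h\<close> that are additive but not
  multiplicative: \<open>zproj\<close> and the extraction of one power of \<open>z\<close>. They are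
  linear over the complex numbers, hence commute with multiplication by polynomials in
  \<open>x\<close> that are constant in \<open>z\<close>.\<close>

lemma map_mult_semilinear:
  fixes p :: "'m::comm_monoid_add \<Rightarrow>\<^sub>0 'a::comm_semiring_1"
    and u :: "'m \<Rightarrow>\<^sub>0 'c::comm_semiring_1"
    and h :: "'c \<Rightarrow> 'd::comm_semiring_1"
  assumes h: "h 0 = 0" "\<And>a b. h (a + b) = h a + h b"
    and e: "e 0 = 0" "\<And>a b. e (a + b) = e a + e b"
    and e': "e' 0 = 0" "\<And>a b. e' (a + b) = e' a + e' b"
    and hom: "\<And>a b. h (e a * b) = e' a * h b"
  shows "Poly_Mapping.map h (Poly_Mapping.map e p * u) = Poly_Mapping.map e' p * Poly_Mapping.map h u"
proof (induction p rule: poly_mapping_additive_induct)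
  case (single m c)
  show ?case
  proof (induction u rule: poly_mapping_additive_induct)
    case (single n d)
    show ?case
      by (simp add: h e e' mult_single hom)
  qed (simp_all add: distrib_left map_0 map_add h)
qed (simp_all add: distrib_right map_0 map_add h e e')

lemma lookup_zC_mult [simp]:
  "Poly_Mapping.lookup (zC c * u) m = c * Poly_Mapping.lookup u m"
  "Poly_Mapping.lookup (u * zC c) m = c * Poly_Mapping.lookup u m"
  by (simp_all add: zC_def lookup_map mult.commute[of u] flip: mult_map_scale_conv_mult)

lemma zC_0 [simp]: "zC 0 = 0" and zC_1 [simp]: "zC 1 = 1"
  and zC_diff: "zC (a - b) = zC a - zC b"
  and zC_minus: "zC (- a) = - zC a" and zC_mult: "zC (a * b) = zC a * zC b"
  by (simp_all add: zC_def single_diff mult_single single_uminus)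

lemma zC_mult_left: "zC a * (zC b * u) = zC (a * b) * u"
  by (simp add: zC_mult mult.assoc)

lemma lookup_emb [simp]: "Poly_Mapping.lookup (emb p) m = fls_const (Poly_Mapping.lookup p m)"
  by (simp add: emb_def lookup_map)

lemma emb_single: "emb (Poly_Mapping.single m c) = Poly_Mapping.single m (fls_const c)"
  by (simp add: emb_def)


lemma lookup_pd:
  "Poly_Mapping.lookup (pd k p) m =
     of_nat (Suc (Poly_Mapping.lookup m k)) * Poly_Mapping.lookup p (m + Poly_Mapping.single k 1)"
proof -
  let ?e = "Poly_Mapping.single k (1::nat)"
  have "Poly_Mapping.lookup (pd k p) m = (\<Sum>n\<in>Poly_Mapping.keys p.
      (if n = m + ?e then of_nat (Poly_Mapping.lookup n k) * Poly_Mapping.lookup p n else 0))"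
    unfolding pd_def lookup_sum
  proof (rule sum.cong[OF refl])
    fix n
    show "Poly_Mapping.lookup (Poly_Mapping.single (n - ?e)
        (of_nat (Poly_Mapping.lookup n k) * Poly_Mapping.lookup p n)) m =
      (if n = m + ?e then of_nat (Poly_Mapping.lookup n k) * Poly_Mapping.lookup p n else 0)"
    \<comment> \<open>Subtraction of exponents is truncated, so \<open>n - ?e = m\<close> can hold
      without \<open>n = m + ?e\<close>; this happens only for exponent 0 at \<open>k\<close>, where
      the coefficient vanishes.\<close>
    proof (cases "Poly_Mapping.lookup n k = 0")
      case False
      then have "n = (n - ?e) + ?e"
        by (intro poly_mapping_eqI) (auto simp: lookup_add lookup_minus lookup_single when_def)
      then have "n - ?e = m \<longleftrightarrow> n = m + ?e"
        by (metis add_diff_cancel_right')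
      then show ?thesis
        by (simp add: lookup_single when_def)
    next
      case True
      then have "n \<noteq> m + ?e"
        by (auto simp: lookup_add)
      with True show ?thesis
        by simp
    qed
  qed
  also have "\<dots> = of_nat (Suc (Poly_Mapping.lookup m k)) * Poly_Mapping.lookup p (m + ?e)"
    by (auto simp: sum.delta in_keys_iff lookup_add)
  finally show ?thesis .
qed

lemma pd_zC_mult: "pd k (zC c * u) = zC c * pd k u"
  by (rule poly_mapping_eqI) (simp add: lookup_pd mult.left_commute)

lemma pd_add: "pd k (u + v) = pd k u + pd k v"
  by (rule poly_mapping_eqI) (simp add: lookup_pd lookup_add algebra_simps)

lemma coeffs_in_0: "0 \<in> A \<Longrightarrow> coeffs_in A 0"
  by (simp add: coeffs_in_def)

lemma coeffs_in_zlaurent_sum: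
  "(\<And>x. x \<in> X \<Longrightarrow> coeffs_in zlaurent (g x)) \<Longrightarrow> coeffs_in zlaurent (sum g X)"
  by (simp add: coeffs_in_def lookup_sum zlaurent_sum)

lemma coeffs_in_zlaurent_mult:
  assumes "coeffs_in zlaurent u" and "coeffs_in zlaurent v"
  shows "coeffs_in zlaurent (u * v)"
proof -
  have "u * v = (\<Sum>m\<in>Poly_Mapping.keys u. \<Sum>n\<in>Poly_Mapping.keys v.
      Poly_Mapping.single (m + n) (Poly_Mapping.lookup u m * Poly_Mapping.lookup v n))"
    by (subst poly_mapping_sum_single[of u], subst poly_mapping_sum_single[of v])
      (simp add: sum_product mult_single)
  moreover have "coeffs_in zlaurent (Poly_Mapping.single m c)" if "c \<in> zlaurent" for m :: "'a \<Rightarrow>\<^sub>0 nat" and c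
    using that by (simp add: coeffs_in_def lookup_single when_def)
  moreover have "Poly_Mapping.lookup u m * Poly_Mapping.lookup v n \<in> zlaurent" for m n
    using assms by (simp add: coeffs_in_def zlaurent_mult)
  ultimately show ?thesis
    by (simp add: coeffs_in_zlaurent_sum)
qed

lemma coeffs_in_zlaurent_zC: "c \<in> zlaurent \<Longrightarrow> coeffs_in zlaurent (zC c)"
  by (simp add: coeffs_in_def zC_def lookup_single when_def)

lemma coeffs_in_zlaurent_emb: "coeffs_in zlaurent (emb p)"
  by (simp add: coeffs_in_def zlaurent_const)


subsection \<open>Nowhere vanishing polynomials\<close>

text \<open>The residue modulo \<open>B\<close> determines the lowest digit; cancelling it and
  dividing by \<open>B\<close> leaves the same statement with one digit less.\<close>

lemma base_expansion_unique:
  fixes a b :: "nat \<Rightarrow> nat"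
  assumes "(\<Sum>i<n. a i * B ^ i) = (\<Sum>i<n. b i * B ^ i)"
    and "\<And>i. i < n \<Longrightarrow> a i < B" and "\<And>i. i < n \<Longrightarrow> b i < B" and "i < n"
  shows "a i = b i"
  using assms
proof (induction n arbitrary: a b i)
  case (Suc n)
  have split: "(\<Sum>i<Suc n. c i * B ^ i) = c 0 + B * (\<Sum>i<n. c (Suc i) * B ^ i)" for c :: "nat \<Rightarrow> nat"
    by (simp only: sum.lessThan_Suc_shift) (simp add: sum_distrib_left algebra_simps)
  have eq: "a 0 + B * (\<Sum>i<n. a (Suc i) * B ^ i) = b 0 + B * (\<Sum>i<n. b (Suc i) * B ^ i)"
    using Suc.prems(1) unfolding split .
  have lt: "a 0 < B" "b 0 < B"
    using Suc.prems by auto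
  have "a 0 = b 0"
    using arg_cong[OF eq, of "\<lambda>x. x mod B"] lt by simp
  moreover have "(\<Sum>i<n. a (Suc i) * B ^ i) = (\<Sum>i<n. b (Suc i) * B ^ i)"
    using eq \<open>a 0 = b 0\<close> lt by simp
  then have "a (Suc j) = b (Suc j)" if "j < n" for j
    using Suc.IH[of "\<lambda>i. a (Suc i)" "\<lambda>i. b (Suc i)" j] Suc.prems that by auto
  ultimately show ?case
    using Suc.prems(4) by (cases i) auto
qed simp

text \<open>
  The Kronecker substitution \<open>x\<^sub>k = T\<^bsup>B^e(k)\<^esup>\<close> keeps the monomials of the polynomial apart when
  \<open>B\<close> exceeds all exponents, so that the claim reduces to one variable.
\<close>
lemma nowhere_vanishing_imp_const:
  fixes p :: "'n::finite cpoly"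
  assumes "\<forall>x. peval p x \<noteq> 0"
  obtains c where "c \<noteq> 0" and "p = Poly_Mapping.single 0 c"
proof -
  obtain e :: "'n \<Rightarrow> nat" and n where e: "bij_betw e UNIV {..<n}"
    using ex_bij_betw_finite_nat[OF finite_class.finite_UNIV] by (auto simp: lessThan_atLeast0)
  define B where "B = Suc (\<Sum>m\<in>Poly_Mapping.keys p. \<Sum>k\<in>UNIV. Poly_Mapping.lookup m k)"
  define w :: "('n \<Rightarrow>\<^sub>0 nat) \<Rightarrow> nat" where "w m = (\<Sum>k\<in>UNIV. Poly_Mapping.lookup m k * B ^ e k)" for m
  \<comment> \<open>The exponent 0 is adjoined even if it does not occur in \<open>p\<close>, so
    that \<open>w m = w 0 = 0\<close> forces \<open>m = 0\<close> for the monomials of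
    \<open>p\<close>.\<close>
  have bound: "Poly_Mapping.lookup m k < B" if "m \<in> insert 0 (Poly_Mapping.keys p)" for m k
  proof (cases "m = 0")
    case False
    have "Poly_Mapping.lookup m k \<le> (\<Sum>k\<in>UNIV. Poly_Mapping.lookup m k)"
      by (rule member_le_sum) auto
    also have "\<dots> \<le> (\<Sum>m\<in>Poly_Mapping.keys p. \<Sum>k\<in>UNIV. Poly_Mapping.lookup m k)"
      using that False by (intro member_le_sum) auto
    finally show ?thesis by (simp add: B_def)
  qed (simp add: B_def)
  have inj: "m = m'" if m: "m \<in> insert 0 (Poly_Mapping.keys p)" "m' \<in> insert 0 (Poly_Mapping.keys p)"
    and eq: "w m = w m'" for m m'
  proof (rule poly_mapping_eqI)
    fix k
    let ?g = "inv_into UNIV e"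
    have reindex: "w m = (\<Sum>i<n. Poly_Mapping.lookup m (?g i) * B ^ i)" for m
      unfolding w_def using e
      by (intro sum.reindex_bij_witness[where i = ?g and j = e])
        (auto simp: bij_betw_def inv_into_f_f f_inv_into_f)
    have "Poly_Mapping.lookup m (?g (e k)) = Poly_Mapping.lookup m' (?g (e k))"
      using eq m e unfolding reindex
      by (intro base_expansion_unique[of "\<lambda>i. Poly_Mapping.lookup m (?g i)" B n "\<lambda>i. Poly_Mapping.lookup m' (?g i)"])
        (auto simp: bij_betw_def bound)
    then show "Poly_Mapping.lookup m k = Poly_Mapping.lookup m' k"
      using e by (simp add: bij_betw_def inv_into_f_f)
  qed
  define Q where "Q = (\<Sum>m\<in>Poly_Mapping.keys p. monom (Poly_Mapping.lookup p m) (w m))"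
  \<comment> \<open>\<open>Q\<close> is the restriction of \<open>p\<close> to a curve, so it has no
    zero either and must be constant.\<close>
  have "poly Q t = peval p (\<chi> k. t ^ (B ^ e k))" for t
    unfolding Q_def peval_def
    by (simp add: poly_sum poly_monom w_def power_sum mult.commute flip: power_mult)
  then have "degree Q = 0"
    using assms fundamental_theorem_of_algebra[of Q] constant_degree[of Q] by auto
  have "Poly_Mapping.lookup p m = 0" if "m \<noteq> 0" for m
  proof (rule ccontr)
    assume "Poly_Mapping.lookup p m \<noteq> 0"
    then have m: "m \<in> Poly_Mapping.keys p"
      by (simp add: in_keys_iff)
    have "w m \<noteq> w 0"
      using inj[of m 0] m that by auto
    moreover have "w 0 = 0"
      by (simp add: w_def)
    ultimately have "w m > 0"
      by simp
    have "coeff Q (w m) = (\<Sum>m'\<in>Poly_Mapping.keys p. if m' = m then Poly_Mapping.lookup p m' else 0)"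
      unfolding Q_def coeff_sum by (rule sum.cong) (use inj m in \<open>auto simp: coeff_monom\<close>)
    also have "\<dots> = Poly_Mapping.lookup p m"
      using m by simp
    finally show False
      using \<open>degree Q = 0\<close> \<open>w m > 0\<close> \<open>Poly_Mapping.lookup p m \<noteq> 0\<close> by (simp add: coeff_eq_0)
  qed
  then have p: "p = Poly_Mapping.single 0 (Poly_Mapping.lookup p 0)"
    by (intro poly_mapping_eqI) (auto simp: lookup_single when_def)
  moreover have "Poly_Mapping.lookup p 0 \<noteq> 0"
  proof
    assume "Poly_Mapping.lookup p 0 = 0"
    with p have "p = 0"
      by simp
    with assms show False
      by (simp add: peval_def)
  qed
  ultimately show ?thesis
    using that by blast
qed


subsection \<open>The image of \<open>zd + df\<and>\<close>\<close>

text \<open>Signs are scalars of square 1: they pass through \<open>pd\<close> and can be absorbed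
  into the components of a form.\<close>

lemma ext_sign_scalar:
  obtains s where "ext_sign k J = zC s" and "s * s = 1"
proof (cases "even (card {j\<in>J. j < k})")
  case True
  with that[of 1] show ?thesis
    by (simp add: ext_sign_def)
next
  case False
  with that[of "- 1"] show ?thesis
    by (simp add: ext_sign_def zC_minus)
qed

lemma ext_sign_empty [simp]: "ext_sign k {} = 1"
  by (simp add: ext_sign_def)

lemma ext_sign_mult_self: "ext_sign k J * (ext_sign k J * u) = u"
  by (rule ext_sign_scalar[of k J]) (simp add: zC_mult_left)

text \<open>A form of degree \<open>N - 1\<close> amounts to \<open>N\<close> functions, its
  coefficients at the sets \<open>UNIV - {k}\<close>. Multiplying each of them by its sign removes
  all signs from the image.\<close>

lemma brieskorn_im_iff:
  "u \<in> brieskorn_im f \<longleftrightarrow> (\<exists>g. u = (\<Sum>k\<in>UNIV. zC (zpow 1) * pd k (g k) + emb (pd k f) * g k))"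
  (is "_ \<longleftrightarrow> ?R")
proof
  have expand: "zC (zpow 1) * form_d \<eta> UNIV + df_wedge f \<eta> UNIV =
      (\<Sum>k\<in>UNIV. zC (zpow 1) * pd k (ext_sign k UNIV * \<eta> (UNIV - {k}))
        + emb (pd k f) * (ext_sign k UNIV * \<eta> (UNIV - {k})))" for \<eta> :: "'a ext"
  proof -
    have "pd k (ext_sign k UNIV * v) = ext_sign k UNIV * pd k v" for k :: 'a and v
      by (rule ext_sign_scalar[of k UNIV]) (simp add: pd_zC_mult)
    then show ?thesis
      by (simp add: form_d_def df_wedge_def sum_distrib_left sum.distrib mult.left_commute)
  qed
  show ?R if u: "u \<in> brieskorn_im f"
  proof -
    obtain \<eta> where "u = zC (zpow 1) * form_d \<eta> UNIV + df_wedge f \<eta> UNIV"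
      using u by (auto simp: brieskorn_im_def)
    then show ?R
      by (intro exI[of _ "\<lambda>k. ext_sign k UNIV * \<eta> (UNIV - {k})"]) (simp add: expand)
  qed
  assume ?R
  then obtain g where g: "u = (\<Sum>k\<in>UNIV. zC (zpow 1) * pd k (g k) + emb (pd k f) * g k)"
    by blast
  \<comment> \<open>At most one summand is nonzero for each \<open>J\<close>; the sign inserted here
    cancels against the one in \<open>form_d\<close> and \<open>df_wedge\<close>.\<close>
  define \<eta> where "\<eta> J = (\<Sum>k\<in>UNIV. if J = UNIV - {k} then ext_sign k UNIV * g k else 0)" for J
  have "UNIV - {k} = UNIV - {l} \<longleftrightarrow> k = l" for k l :: 'a
    by auto
  then have "ext_sign k UNIV * \<eta> (UNIV - {k}) = g k" for k
    by (simp add: \<eta>_def sum.delta ext_sign_mult_self)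
  then have "u = zC (zpow 1) * form_d \<eta> UNIV + df_wedge f \<eta> UNIV"
    by (simp add: expand g)
  moreover have "of_degree (CARD('a) - 1) \<eta>"
    unfolding of_degree_def
  proof (intro allI impI)
    fix J assume "\<eta> J \<noteq> 0"
    have "\<exists>k. J = UNIV - {k}"
    proof (rule ccontr)
      assume "\<nexists>k. J = UNIV - {k}"
      then have "\<eta> J = 0"
        by (simp add: \<eta>_def)
      with \<open>\<eta> J \<noteq> 0\<close> show False ..
    qed
    then show "card J = CARD('a) - 1"
      by (auto simp: card_Diff_singleton)
  qed
  ultimately show "u \<in> brieskorn_im f"
    unfolding brieskorn_im_def by blast
qed

text \<open>Both \<open>pd\<close> and multiplication by \<open>emb (pd k f)\<close> are linear over
  all Laurent series in \<open>1/z\<close>, so the image is a subspace over this field.\<close>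

lemma brieskorn_im_zC_mult: "u \<in> brieskorn_im f \<Longrightarrow> zC c * u \<in> brieskorn_im f"
  unfolding brieskorn_im_iff
proof (elim exE)
  fix g assume "u = (\<Sum>k\<in>UNIV. zC (zpow 1) * pd k (g k) + emb (pd k f) * g k)"
  then show "\<exists>g. zC c * u = (\<Sum>k\<in>UNIV. zC (zpow 1) * pd k (g k) + emb (pd k f) * g k)"
    by (intro exI[of _ "\<lambda>k. zC c * g k"]) (simp add: sum_distrib_left distrib_left pd_zC_mult ac_simps)
qed

lemma brieskorn_im_add: "u \<in> brieskorn_im f \<Longrightarrow> v \<in> brieskorn_im f \<Longrightarrow> u + v \<in> brieskorn_im f"
  unfolding brieskorn_im_iff
proof (elim exE)
  fix g h
  assume "u = (\<Sum>k\<in>UNIV. zC (zpow 1) * pd k (g k) + emb (pd k f) * g k)"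
    and "v = (\<Sum>k\<in>UNIV. zC (zpow 1) * pd k (h k) + emb (pd k f) * h k)"
  then show "\<exists>g. u + v = (\<Sum>k\<in>UNIV. zC (zpow 1) * pd k (g k) + emb (pd k f) * g k)"
    by (intro exI[of _ "\<lambda>k. g k + h k"]) (simp add: sum.distrib distrib_left pd_add ac_simps)
qed

lemma brieskorn_im_0 [simp]: "0 \<in> brieskorn_im f"
  unfolding brieskorn_im_iff
  by (rule exI[of _ "\<lambda>_. 0"]) (simp add: pd_def)

lemma brieskorn_im_minus: "u \<in> brieskorn_im f \<Longrightarrow> - u \<in> brieskorn_im f"
  using brieskorn_im_zC_mult[of u f "- 1"] by (simp add: zC_minus)

lemma brieskorn_im_diff: "u \<in> brieskorn_im f \<Longrightarrow> v \<in> brieskorn_im f \<Longrightarrow> u - v \<in> brieskorn_im f"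
  using brieskorn_im_add[of u f "- v"] by (simp add: brieskorn_im_minus)

lemma brieskorn_im_sum: "(\<And>x. x \<in> A \<Longrightarrow> g x \<in> brieskorn_im f) \<Longrightarrow> sum g A \<in> brieskorn_im f"
  by (induction A rule: infinite_finite_induct) (auto intro: brieskorn_im_add)


subsection \<open>Weight components\<close>

text \<open>The scalar version of \<open>wcomp\<close>. The index is rational because weights are;
  an index that is not an integer is no power of \<open>z\<close> and gives 0.\<close>

definition zterm :: "rat \<Rightarrow> complex fls \<Rightarrow> complex fls" where
  "zterm r c = (if r \<in> \<int> then fls_const (zcoeff c \<lfloor>r\<rfloor>) * zpow \<lfloor>r\<rfloor> else 0)"

lemma zterm_0 [simp]: "zterm r 0 = 0"
  by (simp add: zterm_def)

lemma zterm_add: "zterm r (a + b) = zterm r a + zterm r b"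
  by (simp add: zterm_def distrib_right flip: fls_plus_const)

lemma zterm_const_mult: "zterm r (fls_const c * a) = fls_const c * zterm r a"
  by (simp add: zterm_def mult.assoc flip: fls_const_mult_const)

text \<open>As \<open>zterm s c\<close> is a multiple of the single power \<open>z^s\<close> or 0,
  only the term of \<open>d\<close> with index \<open>r - s\<close> can land in index
  \<open>r\<close>. For integral \<open>s\<close>, the indices \<open>r\<close> and
  \<open>r - s\<close> are integral together.\<close>

lemma zterm_mult_zterm: "zterm r (d * zterm s c) = zterm (r - s) d * zterm s c"
proof (cases "s \<in> \<int>")
  case s: True
  show ?thesis
  proof (cases "r \<in> \<int>")
    case True
    with s obtain i j where ij: "r = of_int i" "s = of_int j"
      by (auto elim!: Ints_cases)
    have rs: "\<lfloor>r - s\<rfloor> = i - j" "\<lfloor>r\<rfloor> = i" "\<lfloor>s\<rfloor> = j" "r - s \<in> \<int>" "r \<in> \<int>" "s \<in> \<int>"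
      using ij by (simp_all flip: of_int_diff)
    have "d * (fls_const (zcoeff c j) * zpow j) = fls_const (zcoeff c j) * (zpow j * d)"
      by (simp add: ac_simps)
    then have "zterm r (d * zterm s c) = fls_const (zcoeff c j) * (fls_const (zcoeff d (i - j)) * zpow i)"
      by (simp add: zterm_def rs flip: fls_const_mult_const mult.assoc)
    also have "\<dots> = zterm (r - s) d * zterm s c"
      using zpow_mult[of "i - j" j] by (simp add: zterm_def rs ac_simps)
    finally show ?thesis .
  next
    case False
    then have "r - s \<notin> \<int>"
      using s Ints_add[of "r - s" s] by auto
    with False show ?thesis
      by (simp add: zterm_def)
  qed
qed (simp add: zterm_def)

lemma zterm_shift: "zterm r (zpow 1 * c) = zpow 1 * zterm (r - 1) c"
proof (cases "r \<in> \<int>")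
  case True
  then obtain i where i: "r = of_int i"
    by (auto elim: Ints_cases)
  then have ii: "\<lfloor>r\<rfloor> = i" "\<lfloor>r - 1\<rfloor> = i - 1" "r - 1 \<in> \<int>"
    by (simp_all add: floor_diff_one)
  show ?thesis
    using zpow_mult[of 1 "i - 1"] True by (simp add: zterm_def ii ac_simps)
next
  case False
  then have "r - 1 \<notin> \<int>"
    using Ints_add[of "r - 1" 1] by auto
  with False show ?thesis
    by (simp add: zterm_def)
qed

lemma lookup_wcomp [simp]:
  "Poly_Mapping.lookup (wcomp q r u) m = zterm (r - wt q m) (Poly_Mapping.lookup u m)"
  unfolding wcomp_def lookup_sum zterm_def[symmetric]
  by (auto simp: lookup_single when_def in_keys_iff)

lemma wcomp_add: "wcomp q r (u + v) = wcomp q r u + wcomp q r v"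
  by (rule poly_mapping_eqI) (simp add: lookup_add zterm_add)

lemma wcomp_0 [simp]: "wcomp q r 0 = 0"
  by (rule poly_mapping_eqI) simp

lemma wcomp_sum: "wcomp q r (sum g A) = (\<Sum>x\<in>A. wcomp q r (g x))"
  by (induction A rule: infinite_finite_induct) (auto simp: wcomp_add)

lemma wcomp_zC_mult_wcomp: "wcomp q r (zC d * wcomp q s u) = zC (zterm (r - s) d) * wcomp q s u"
  by (rule poly_mapping_eqI) (simp add: zterm_mult_zterm)

lemma wt_add: "wt q (m + n) = wt q m + wt q n"
  by (simp add: wt_def lookup_add distrib_right sum.distrib)

lemma wt_single: "wt q (Poly_Mapping.single k 1) = q k"
  by (simp add: wt_def lookup_single when_def if_distrib if_distribR cong: if_cong)

lemma wcomp_single: "wcomp q r (Poly_Mapping.single m c) = Poly_Mapping.single m (zterm (r - wt q m) c)"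
  by (rule poly_mapping_eqI) (simp add: lookup_single when_def)

lemma wcomp_homogeneous_mult:
  assumes "\<forall>m\<in>Poly_Mapping.keys p. wt q m = s"
  shows "wcomp q r (emb p * u) = emb p * wcomp q (r - s) u"
proof -
  have "wcomp q r (Poly_Mapping.single m (fls_const c) * v) =
      Poly_Mapping.single m (fls_const c) * wcomp q (r - s) v" if "wt q m = s" for m c v
    using that
    by (induction v rule: poly_mapping_additive_induct)
      (simp_all add: distrib_left wcomp_add wcomp_single mult_single zterm_const_mult wt_add diff_diff_eq)
  moreover have "emb p = (\<Sum>m\<in>Poly_Mapping.keys p. Poly_Mapping.single m (fls_const (Poly_Mapping.lookup p m)))"
    by (rule poly_mapping_eqI) (auto simp: lookup_sum lookup_single when_def in_keys_iff)
  ultimately show ?thesis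
    using assms by (simp add: sum_distrib_right wcomp_sum)
qed

text \<open>\<open>pd k\<close> lowers weights by \<open>q k\<close> and \<open>z\<close> raises
  them by 1.\<close>

lemma wcomp_z_pd: "wcomp q r (zC (zpow 1) * pd k u) = zC (zpow 1) * pd k (wcomp q (r - 1 + q k) u)"
proof (rule poly_mapping_eqI)
  fix m
  show "Poly_Mapping.lookup (wcomp q r (zC (zpow 1) * pd k u)) m =
      Poly_Mapping.lookup (zC (zpow 1) * pd k (wcomp q (r - 1 + q k) u)) m"
    using wt_single[of q k]
    by (simp add: lookup_pd zterm_shift zterm_const_mult wt_add fls_of_nat diff_diff_eq add.commute
        del: of_nat_Suc)
qed

text \<open>Quasihomogeneity gives \<open>pd k f\<close> the weight \<open>1 - q k\<close>, by which
  \<open>z * pd k\<close> shifts weights as well. Both terms of a summand therefore involve the same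
  component of \<open>g k\<close>.\<close>

lemma brieskorn_im_wcomp:
  assumes "quasihomogeneous q f" and "u \<in> brieskorn_im f"
  shows "wcomp q r u \<in> brieskorn_im f"
proof -
  obtain g where g: "u = (\<Sum>k\<in>UNIV. zC (zpow 1) * pd k (g k) + emb (pd k f) * g k)"
    using assms(2) brieskorn_im_iff by blast
  have "wcomp q r (emb (pd k f) * v) = emb (pd k f) * wcomp q (r - 1 + q k) v" for k v
  proof -
    have "wt q m = 1 - q k" if "m \<in> Poly_Mapping.keys (pd k f)" for m
    proof -
      have "m + Poly_Mapping.single k 1 \<in> Poly_Mapping.keys f"
        using that by (auto simp: in_keys_iff lookup_pd)
      then have "wt q (m + Poly_Mapping.single k 1) = 1"
        using assms(1) unfolding quasihomogeneous_def by blast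
      then show ?thesis
        by (simp only: wt_add wt_single)
    qed
    then show ?thesis
      by (subst wcomp_homogeneous_mult[where s = "1 - q k"]) (auto simp: algebra_simps)
  qed
  then have "wcomp q r u = (\<Sum>k\<in>UNIV. zC (zpow 1) * pd k (wcomp q (r - 1 + q k) (g k))
      + emb (pd k f) * wcomp q (r - 1 + q k) (g k))"
    by (simp add: g wcomp_sum wcomp_add wcomp_z_pd)
  then show ?thesis
    unfolding brieskorn_im_iff by (rule exI[of _ "\<lambda>k. wcomp q (r - 1 + q k) (g k)"])
qed

text \<open>
  No completeness of \<open>\<L>\<close> in the \<open>z\<^sup>-\<^sup>1\<close>-adic topology is assumed.  A weight component of a
  relation over \<open>\<complex>((z\<^sup>-\<^sup>1))\<close> has monomial coefficients; after shifting the top power of \<open>z\<close> to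
  \<open>z\<^sup>0\<close>, the part with negative powers lies in \<open>\<L>\<close>, so the top part lies in \<open>\<H>\<^sub>f\<^sup>(\<^sup>0\<^sup>) \<inter> \<L> = 0\<close>.
\<close>
lemma good_basis_independent:
  assumes qh: "quasihomogeneous q f" and L: "good_opposite q f L" and \<omega>: "good_basis q f L \<omega>"
    and rel: "(\<Sum>\<alpha>\<in>UNIV. zC (d \<alpha>) * \<omega> \<alpha>) \<in> brieskorn_im f"
  shows "d \<alpha> = 0"
proof (rule ccontr)
  assume "d \<alpha> \<noteq> 0"
  then obtain k where k: "zcoeff (d \<alpha>) k \<noteq> 0"
    using fls_eq_zcoeffI[of "d \<alpha>" 0] by auto
  obtain w where w: "\<omega> \<beta> - wcomp q (w \<beta>) (\<omega> \<beta>) \<in> brieskorn_im f" for \<beta>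
    using \<omega> unfolding good_basis_def by metis
  \<comment> \<open>With this weight \<open>r - w \<alpha> = k\<close>, so the term
    \<open>z^k\<close> of \<open>d \<alpha>\<close> survives in \<open>a \<alpha>\<close>.\<close>
  define r where "r = w \<alpha> + of_int k"
  define a where "a \<beta> = zterm (r - w \<beta>) (d \<beta>)" for \<beta>
  have rel_a: "(\<Sum>\<beta>\<in>UNIV. zC (a \<beta>) * \<omega> \<beta>) \<in> brieskorn_im f"
  proof -
    \<comment> \<open>Each \<open>\<omega> \<beta>\<close> is homogeneous only modulo the image.
      Homogeneous representatives replace them before the weight component is taken and are replaced
      back afterwards.\<close>
    let ?\<omega> = "\<lambda>\<beta>. wcomp q (w \<beta>) (\<omega> \<beta>)"
    have eq: "(\<Sum>\<beta>\<in>UNIV. zC (c \<beta>) * \<omega> \<beta>) =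
        (\<Sum>\<beta>\<in>UNIV. zC (c \<beta>) * ?\<omega> \<beta>) + (\<Sum>\<beta>\<in>UNIV. zC (c \<beta>) * (\<omega> \<beta> - ?\<omega> \<beta>))" for c
      by (simp add: algebra_simps flip: sum.distrib)
    have diff: "(\<Sum>\<beta>\<in>UNIV. zC (c \<beta>) * (\<omega> \<beta> - ?\<omega> \<beta>)) \<in> brieskorn_im f" for c
      by (intro brieskorn_im_sum brieskorn_im_zC_mult w)
    have "(\<Sum>\<beta>\<in>UNIV. zC (d \<beta>) * ?\<omega> \<beta>) \<in> brieskorn_im f"
      using brieskorn_im_diff[OF rel diff[of d]] by (simp add: eq[of d])
    from brieskorn_im_wcomp[OF qh this, of r]
    have "(\<Sum>\<beta>\<in>UNIV. zC (a \<beta>) * ?\<omega> \<beta>) \<in> brieskorn_im f"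
      by (simp add: wcomp_sum wcomp_zC_mult_wcomp a_def)
    from brieskorn_im_add[OF this diff[of a]] show ?thesis
      by (simp add: eq[of a])
  qed
  define e where "e \<beta> = \<lfloor>r - w \<beta>\<rfloor>" for \<beta>
  define b where "b \<beta> = (if r - w \<beta> \<in> \<int> then zcoeff (d \<beta>) (e \<beta>) else 0)" for \<beta>
  have a_eq: "a \<beta> = fls_const (b \<beta>) * zpow (e \<beta>)" for \<beta>
    by (simp add: a_def b_def e_def zterm_def)
  have b_\<alpha>: "b \<alpha> \<noteq> 0"
    using k by (simp add: b_def e_def r_def)
  define P where "P = {\<beta>. b \<beta> \<noteq> 0}"
  \<comment> \<open>The highest power of \<open>z\<close> with nonzero coefficient in the
    homogeneous relation; multiplication by \<open>z^(-M)\<close> moves it to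
    \<open>z^0\<close>.\<close>
  define M where "M = Max (e ` P)"
  have M: "e \<beta> \<le> M" if "\<beta> \<in> P" for \<beta>
    unfolding M_def using that by (intro Max_ge) auto
  have "M \<in> e ` P"
    unfolding M_def using b_\<alpha> by (intro Max_in) (auto simp: P_def)
  then obtain \<gamma> where \<gamma>: "\<gamma> \<in> P" "e \<gamma> = M"
    by auto
  define c where "c \<beta> = (if e \<beta> = M then b \<beta> else 0)" for \<beta>
  let ?top = "\<Sum>\<beta>\<in>UNIV. zC (fls_const (c \<beta>)) * \<omega> \<beta>"
  let ?low = "\<Sum>\<beta>\<in>UNIV. if e \<beta> \<noteq> M then zC (fls_const (b \<beta>) * zpow (e \<beta> - M)) * \<omega> \<beta> else 0"
  have sum: "?top + ?low \<in> brieskorn_im f"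
  proof -
    have "zC (zpow (- M)) * (zC (a \<beta>) * \<omega> \<beta>) =
        zC (fls_const (c \<beta>)) * \<omega> \<beta> +
        (if e \<beta> \<noteq> M then zC (fls_const (b \<beta>) * zpow (e \<beta> - M)) * \<omega> \<beta> else 0)" for \<beta>
    proof -
      have "zpow (- M) * (fls_const (b \<beta>) * zpow (e \<beta>)) = fls_const (b \<beta>) * zpow (e \<beta> - M)"
        by (subst mult.left_commute) (simp add: zpow_mult)
      then have "zC (zpow (- M)) * (zC (a \<beta>) * \<omega> \<beta>) = zC (fls_const (b \<beta>) * zpow (e \<beta> - M)) * \<omega> \<beta>"
        by (simp only: a_eq zC_mult_left)
      then show ?thesis
        by (cases "e \<beta> = M") (simp_all add: c_def del: mult_cancel_right)
    qed
    then show ?thesis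
      using brieskorn_im_zC_mult[OF rel_a, of "zpow (- M)"] by (simp add: sum_distrib_left sum.distrib)
  qed
  have L_add: "u + v \<in> L" if "u \<in> L" "v \<in> L" for u v
    using L that unfolding good_opposite_def by blast
  have L_scale: "zC (fls_const x) * u \<in> L" if "u \<in> L" for u x
    using L that unfolding good_opposite_def by blast
  have L_im: "brieskorn_im f \<subseteq> L" and L_0: "0 \<in> L"
    using L brieskorn_im_0 unfolding good_opposite_def by blast+
  have L_sum: "sum g A \<in> L" if "\<And>x. x \<in> A \<Longrightarrow> g x \<in> L" for g :: "'b \<Rightarrow> 'a zpoly" and A
    using that by (induction A rule: infinite_finite_induct) (auto intro: L_add L_0)
  \<comment> \<open>Elements of \<open>opposite_B f L\<close> lie in \<open>z L\<close>, so
    \<open>z^(-1) * \<omega> \<beta>\<close> is in \<open>L\<close>; stability of \<open>L\<close>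
    under \<open>z^(-1)\<close> gives all lower powers.\<close>
  have L_\<omega>: "zC (zpow (- int (Suc n))) * \<omega> \<beta> \<in> L" for n \<beta>
  proof (induction n)
    case 0
    obtain l where "l \<in> L" "\<omega> \<beta> = zC (zpow 1) * l"
      using \<omega> unfolding good_basis_def opposite_B_def by blast
    then show ?case
      by (simp add: zC_mult_left zpow_mult)
  next
    case (Suc n)
    then have "zC (zpow (- 1)) * (zC (zpow (- int (Suc n))) * \<omega> \<beta>) \<in> L"
      using L unfolding good_opposite_def by blast
    moreover have "- 1 + - int (Suc n) = - int (Suc (Suc n))"
      by simp
    ultimately show ?case
      by (simp only: zC_mult_left zpow_mult)
  qed
  have "?low \<in> L"
  proof (rule L_sum)
    fix \<beta>
    show "(if e \<beta> \<noteq> M then zC (fls_const (b \<beta>) * zpow (e \<beta> - M)) * \<omega> \<beta> else 0) \<in> L"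
    proof (cases "e \<beta> \<noteq> M \<and> \<beta> \<in> P")
      case True
      then have "e \<beta> - M = - int (Suc (nat (M - e \<beta> - 1)))"
        using M[of \<beta>] by simp
      then show ?thesis
        using True L_scale[OF L_\<omega>[of "nat (M - e \<beta> - 1)" \<beta>], of "b \<beta>"] by (simp add: zC_mult_left)
    qed (auto simp: P_def L_0)
  qed
  have "?top \<in> L"
    using L_add[OF subsetD[OF L_im sum] L_scale[OF \<open>?low \<in> L\<close>, of "- 1"]] by (simp add: zC_minus)
  moreover have "?top \<in> brieskorn0 f"
  proof -
    have "\<forall>\<beta>. \<exists>v w. \<omega> \<beta> = v + w \<and> coeffs_in zpolys v \<and> w \<in> brieskorn_im f"
      using \<omega> unfolding good_basis_def opposite_B_def brieskorn0_def by blast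
    then obtain v v' where v: "\<And>\<beta>. \<omega> \<beta> = v \<beta> + v' \<beta>" "\<And>\<beta>. coeffs_in zpolys (v \<beta>)"
        "\<And>\<beta>. v' \<beta> \<in> brieskorn_im f"
      by metis
    have "?top = (\<Sum>\<beta>\<in>UNIV. zC (fls_const (c \<beta>)) * v \<beta>) + (\<Sum>\<beta>\<in>UNIV. zC (fls_const (c \<beta>)) * v' \<beta>)"
      by (simp add: v(1) distrib_left sum.distrib)
    moreover have "coeffs_in zpolys (\<Sum>\<beta>\<in>UNIV. zC (fls_const (c \<beta>)) * v \<beta>)"
      using v(2) by (simp add: coeffs_in_def zpolys_def lookup_sum)
    moreover have "(\<Sum>\<beta>\<in>UNIV. zC (fls_const (c \<beta>)) * v' \<beta>) \<in> brieskorn_im f"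
      by (intro brieskorn_im_sum brieskorn_im_zC_mult v)
    ultimately show ?thesis
      unfolding brieskorn0_def by blast
  qed
  ultimately have top: "?top \<in> brieskorn_im f"
    using L unfolding good_opposite_def by blast
  have "0 \<in> brieskorn0 f"
    unfolding brieskorn0_def mem_Collect_eq
    by (intro exI[of _ 0] conjI) (simp_all add: coeffs_in_def zpolys_def)
  then have "0 \<in> opposite_B f L"
    unfolding opposite_B_def using L_0 by (auto intro!: bexI[of _ 0])
  \<comment> \<open>The zero class has unique coordinates in the good basis. Both \<open>c\<close>
    and the zero family are such coordinates, against \<open>c \<gamma> \<noteq> 0\<close>.\<close>
  define Q where "Q c \<longleftrightarrow> 0 - (\<Sum>\<beta>\<in>UNIV. zC (fls_const (c \<beta>)) * \<omega> \<beta>) \<in> brieskorn_im f" for c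
  have "\<exists>!c. Q c"
    using \<omega> \<open>0 \<in> opposite_B f L\<close> unfolding good_basis_def Q_def by (elim conjE) (erule bspec)
  moreover have "Q c" and "Q (\<lambda>_. 0)"
    using brieskorn_im_minus[OF top] by (simp_all add: Q_def)
  ultimately have "c = (\<lambda>_. 0)"
    by blast
  then have "c \<gamma> = 0"
    by simp
  with \<gamma> show False
    by (auto simp: c_def P_def)
qed


subsection \<open>Classes in the Jacobian ring\<close>

text \<open>Reduces questions with coefficients in powers of \<open>z\<close> to polynomials over
  the complex numbers, where \<open>jac_basis\<close> applies.\<close>

definition zslice :: "int \<Rightarrow> 'n zpoly \<Rightarrow> 'n cpoly" where
  "zslice k u = Poly_Mapping.map (\<lambda>c. zcoeff c k) u"

lemma lookup_zslice [simp]: "Poly_Mapping.lookup (zslice k u) m = zcoeff (Poly_Mapping.lookup u m) k"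
  by (simp add: zslice_def lookup_map)

lemma zpoly_eq_zsliceI: "(\<And>k. zslice k u = zslice k v) \<Longrightarrow> u = v"
  by (intro poly_mapping_eqI fls_eq_zcoeffI) (metis lookup_zslice)

lemma zslice_add: "zslice k (u + v) = zslice k u + zslice k v"
  by (rule poly_mapping_eqI) (simp add: lookup_add)

lemma zslice_0 [simp]: "zslice k 0 = 0"
  by (rule poly_mapping_eqI) simp

lemma zslice_sum: "zslice k (sum g A) = (\<Sum>x\<in>A. zslice k (g x))"
  by (induction A rule: infinite_finite_induct) (auto simp: zslice_add)

lemma zslice_emb_mult: "zslice k (emb p * u) = p * zslice k u"
proof -
  have "Poly_Mapping.map (\<lambda>c. zcoeff c k) (Poly_Mapping.map fls_const p * u) =
      Poly_Mapping.map id p * Poly_Mapping.map (\<lambda>c. zcoeff c k) u"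
    by (rule map_mult_semilinear) (simp_all flip: fls_plus_const)
  moreover have "Poly_Mapping.map id p = p"
    by (rule poly_mapping_eqI) (simp add: lookup_map)
  ultimately show ?thesis
    by (simp add: zslice_def emb_def)
qed

lemma zslice_zC: "zslice k (zC c) = Poly_Mapping.single 0 (zcoeff c k)"
  by (rule poly_mapping_eqI) (simp add: zC_def lookup_single when_def)

lemma zslice_zC_emb: "zslice k (zC c * emb p) = Poly_Mapping.single 0 (zcoeff c k) * p"
  by (metis mult.commute zslice_emb_mult zslice_zC)

lemma map_zproj_emb_mult: "Poly_Mapping.map zproj (emb p * u) = emb p * Poly_Mapping.map zproj u"
  unfolding emb_def
  by (rule map_mult_semilinear) (simp_all add: zproj_add zproj_const_mult flip: fls_plus_const)

lemma jacobian_idealI: "(\<Sum>k\<in>UNIV. g k * pd k f) \<in> jacobian_ideal f"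
  by (auto simp: jacobian_ideal_def)

text \<open>Each power of \<open>z\<close> is decomposed separately by \<open>jac_basis\<close>;
  only finitely many powers occur in \<open>h\<close>, so the pieces reassemble with coefficients
  that are again finite in \<open>z\<close>.\<close>

lemma jac_decomposition:
  assumes \<phi>: "jac_basis f \<phi>" and h: "coeffs_in zlaurent h"
  obtains c g where "\<And>\<alpha>. c \<alpha> \<in> zlaurent" and "\<And>k. coeffs_in zlaurent (g k)"
    and "h = (\<Sum>\<alpha>\<in>UNIV. zC (c \<alpha>) * emb (\<phi> \<alpha>)) + (\<Sum>k\<in>UNIV. emb (pd k f) * g k)"
proof -
  define K where "K = (\<Union>m\<in>Poly_Mapping.keys h. {k. zcoeff (Poly_Mapping.lookup h m) k \<noteq> 0})"
  have "finite K"
    using h by (auto simp: K_def coeffs_in_def zlaurent_def)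
  have K: "zslice i h = 0" if "i \<notin> K" for i
  proof (rule poly_mapping_eqI)
    fix m show "Poly_Mapping.lookup (zslice i h) m = Poly_Mapping.lookup 0 m"
      using that by (cases "Poly_Mapping.lookup h m = 0") (auto simp: K_def in_keys_iff)
  qed
  have "\<forall>i. \<exists>c g. zslice i h = (\<Sum>\<alpha>\<in>UNIV. Poly_Mapping.single 0 (c \<alpha>) * \<phi> \<alpha>) + (\<Sum>k\<in>UNIV. pd k f * g k)"
  proof
    fix i
    obtain c where "zslice i h - (\<Sum>\<alpha>\<in>UNIV. Poly_Mapping.single 0 (c \<alpha>) * \<phi> \<alpha>) \<in> jacobian_ideal f"
      using \<phi>[unfolded jac_basis_def, rule_format, of "zslice i h"] by (rule ex1E)
    then obtain g where "zslice i h - (\<Sum>\<alpha>\<in>UNIV. Poly_Mapping.single 0 (c \<alpha>) * \<phi> \<alpha>) = (\<Sum>k\<in>UNIV. g k * pd k f)"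
      unfolding jacobian_ideal_def by auto
    then show "\<exists>c g. zslice i h = (\<Sum>\<alpha>\<in>UNIV. Poly_Mapping.single 0 (c \<alpha>) * \<phi> \<alpha>) + (\<Sum>k\<in>UNIV. pd k f * g k)"
      by (intro exI[of _ c] exI[of _ g]) (simp add: diff_eq_eq add.commute mult.commute)
  qed
  from choice[OF this] obtain c where
    "\<forall>i. \<exists>g. zslice i h = (\<Sum>\<alpha>\<in>UNIV. Poly_Mapping.single 0 (c i \<alpha>) * \<phi> \<alpha>) + (\<Sum>k\<in>UNIV. pd k f * g k)" ..
  from choice[OF this] obtain g where
    cg: "\<forall>i. zslice i h = (\<Sum>\<alpha>\<in>UNIV. Poly_Mapping.single 0 (c i \<alpha>) * \<phi> \<alpha>) + (\<Sum>k\<in>UNIV. pd k f * g i k)" ..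
  \<comment> \<open>The sums run over \<open>K\<close> only: for \<open>i\<close> outside
    \<open>K\<close> the slice of \<open>h\<close> is 0, but the chosen \<open>g i k\<close> need
    not vanish.\<close>
  define c' where "c' \<alpha> = (\<Sum>i\<in>K. fls_const (c i \<alpha>) * zpow i)" for \<alpha>
  define g' where "g' k = (\<Sum>i\<in>K. zC (zpow i) * emb (g i k))" for k
  have c': "zcoeff (c' \<alpha>) i = (if i \<in> K then c i \<alpha> else 0)" for \<alpha> i
    using \<open>finite K\<close> by (simp add: c'_def zcoeff_zpow if_distrib cong: if_cong)
  have g': "zslice i (g' k) = (if i \<in> K then g i k else 0)" for i k
  proof -
    have "zslice i (g' k) = (\<Sum>j\<in>K. if i = j then g j k else 0)"
      unfolding g'_def zslice_sum zslice_zC_emb by (rule sum.cong) (auto simp: zcoeff_zpow)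
    then show ?thesis
      using \<open>finite K\<close> by simp
  qed
  show thesis
  proof
    show "c' \<alpha> \<in> zlaurent" for \<alpha>
      unfolding c'_def by (intro zlaurent_sum zlaurent_const_mult zlaurent_zpow)
    show "coeffs_in zlaurent (g' k)" for k
      unfolding g'_def
      by (intro coeffs_in_zlaurent_sum coeffs_in_zlaurent_mult coeffs_in_zlaurent_zC coeffs_in_zlaurent_emb zlaurent_zpow)
    show "h = (\<Sum>\<alpha>\<in>UNIV. zC (c' \<alpha>) * emb (\<phi> \<alpha>)) + (\<Sum>k\<in>UNIV. emb (pd k f) * g' k)"
    proof (rule zpoly_eq_zsliceI)
      fix i
      have "zslice i ((\<Sum>\<alpha>\<in>UNIV. zC (c' \<alpha>) * emb (\<phi> \<alpha>)) + (\<Sum>k\<in>UNIV. emb (pd k f) * g' k)) =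
          (if i \<in> K then (\<Sum>\<alpha>\<in>UNIV. Poly_Mapping.single 0 (c i \<alpha>) * \<phi> \<alpha>) + (\<Sum>k\<in>UNIV. pd k f * g i k) else 0)"
        by (simp add: zslice_add zslice_sum zslice_zC_emb zslice_emb_mult c' g')
      then show "zslice i h =
          zslice i ((\<Sum>\<alpha>\<in>UNIV. zC (c' \<alpha>) * emb (\<phi> \<alpha>)) + (\<Sum>k\<in>UNIV. emb (pd k f) * g' k))"
        using K cg by simp
    qed
  qed
qed

lemma pv_dbar_empty: "pv_dbar f \<eta> {} = (\<Sum>k\<in>UNIV. emb (pd k f) * \<eta> {k})"
  by (simp add: pv_dbar_def)

text \<open>The component at \<open>{}\<close> of \<open>pv_dbar f \<eta>\<close> has all its slices
  in the Jacobian ideal. By uniqueness in \<open>jac_basis\<close>, two coordinate families of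
  \<open>v\<close> agree slice by slice.\<close>

lemma jac_class_eqI:
  assumes \<phi>: "jac_basis f \<phi>" and c: "\<And>\<alpha>. c \<alpha> \<in> zlaurent" and \<eta>: "\<eta> \<in> PV zlaurent"
    and v: "v = pv_add (pv_fun (\<Sum>\<alpha>\<in>UNIV. zC (c \<alpha>) * emb (\<phi> \<alpha>))) (pv_dbar f \<eta>)"
  shows "jac_class f \<phi> v = c"
  unfolding jac_class_def
proof (rule the_equality)
  show "(\<forall>\<alpha>. c \<alpha> \<in> zlaurent) \<and>
     (\<exists>\<eta>\<in>PV zlaurent. v = pv_add (pv_fun (\<Sum>\<alpha>\<in>UNIV. zC (c \<alpha>) * emb (\<phi> \<alpha>))) (pv_dbar f \<eta>))"
    using c \<eta> v by blast
next
  fix c'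
  assume "(\<forall>\<alpha>. c' \<alpha> \<in> zlaurent) \<and>
     (\<exists>\<eta>\<in>PV zlaurent. v = pv_add (pv_fun (\<Sum>\<alpha>\<in>UNIV. zC (c' \<alpha>) * emb (\<phi> \<alpha>))) (pv_dbar f \<eta>))"
  then obtain \<eta>' where v': "v = pv_add (pv_fun (\<Sum>\<alpha>\<in>UNIV. zC (c' \<alpha>) * emb (\<phi> \<alpha>))) (pv_dbar f \<eta>')"
    by blast
  have "(\<Sum>\<alpha>\<in>UNIV. zC (c \<alpha>) * emb (\<phi> \<alpha>)) + (\<Sum>k\<in>UNIV. emb (pd k f) * \<eta> {k}) =
      (\<Sum>\<alpha>\<in>UNIV. zC (c' \<alpha>) * emb (\<phi> \<alpha>)) + (\<Sum>k\<in>UNIV. emb (pd k f) * \<eta>' {k})"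
    using fun_cong[OF trans[OF v[symmetric] v'], of "{}"] by (simp add: pv_add_def pv_fun_def pv_dbar_empty)
  then have eq: "(\<Sum>\<alpha>\<in>UNIV. Poly_Mapping.single 0 (zcoeff (c \<alpha>) i) * \<phi> \<alpha>) + (\<Sum>k\<in>UNIV. pd k f * zslice i (\<eta> {k})) =
      (\<Sum>\<alpha>\<in>UNIV. Poly_Mapping.single 0 (zcoeff (c' \<alpha>) i) * \<phi> \<alpha>) + (\<Sum>k\<in>UNIV. pd k f * zslice i (\<eta>' {k}))"
    (is "?p c + ?g \<eta> = ?p c' + ?g \<eta>'") for i
    by (drule_tac arg_cong[of _ _ "zslice i"]) (simp add: zslice_add zslice_sum zslice_zC_emb zslice_emb_mult)
  have "zcoeff (c' \<alpha>) i = zcoeff (c \<alpha>) i" for \<alpha> i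
  proof -
    define p where "p d = (\<Sum>\<alpha>\<in>UNIV. Poly_Mapping.single 0 (d \<alpha>) * \<phi> \<alpha>)" for d :: "'b \<Rightarrow> complex"
    let ?d = "\<lambda>\<alpha>. zcoeff (c \<alpha>) i" and ?d' = "\<lambda>\<alpha>. zcoeff (c' \<alpha>) i"
    have unique: "\<exists>!d. p ?d - p d \<in> jacobian_ideal f"
      using \<phi> unfolding jac_basis_def p_def by blast
    have "p ?d - p ?d' = (\<Sum>k\<in>UNIV. (zslice i (\<eta>' {k}) - zslice i (\<eta> {k})) * pd k f)"
      using eq[of i] by (simp add: p_def algebra_simps sum_subtractf)
    then have "p ?d - p ?d' \<in> jacobian_ideal f"
      by (simp only: jacobian_idealI)
    moreover have "p ?d - p ?d \<in> jacobian_ideal f"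
      using jacobian_idealI[of "\<lambda>_. 0" f] by simp
    ultimately have "?d' = ?d"
      using unique by blast
    then show ?thesis
      by (rule fun_cong)
  qed
  then show "c' = c"
    by (intro ext fls_eq_zcoeffI)
qed


subsection \<open>Trivializations\<close>

lemma pv_scale_pv_scale: "pv_scale a (pv_scale b v) = pv_scale (a * b) v"
  by (simp add: pv_scale_def zC_mult_left)

lemma pv_scale_1 [simp]: "pv_scale 1 v = v"
  by (simp add: pv_scale_def)

lemma pv_scale_zpow_cancel:
  "pv_scale (zpow (- M)) (pv_scale (zpow M) v) = v" "pv_scale (zpow M) (pv_scale (zpow (- M)) v) = v"
  by (simp_all add: pv_scale_pv_scale zpow_mult)

lemma pv_scale_fun: "pv_scale c (pv_fun g) = pv_fun (zC c * g)"
  by (auto simp: pv_scale_def pv_fun_def)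

lemma pv_add_fun: "pv_add (pv_fun g) (pv_fun h) = pv_fun (g + h)"
  by (auto simp: pv_add_def pv_fun_def)

lemma of_degree_0_iff: "of_degree 0 v \<longleftrightarrow> v = pv_fun (v {})" for v :: "'n::finite ext"
  unfolding of_degree_def pv_fun_def fun_eq_iff card_0_eq[OF finite] by metis

lemma PV_mono: "A \<subseteq> B \<Longrightarrow> PV A \<subseteq> PV B"
  by (auto simp: PV_def coeffs_in_def)

lemma PV_fun: "0 \<in> A \<Longrightarrow> coeffs_in A g \<Longrightarrow> pv_fun g \<in> PV A"
  by (simp add: PV_def pv_fun_def coeffs_in_0)

lemma PV_zlaurent_scale: "c \<in> zlaurent \<Longrightarrow> v \<in> PV zlaurent \<Longrightarrow> pv_scale c v \<in> PV zlaurent"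
  by (simp add: PV_def pv_scale_def coeffs_in_zlaurent_mult coeffs_in_zlaurent_zC)

text \<open>Finitely many \<open>J\<close>, monomials and powers of \<open>z\<close> occur in
  \<open>v\<close>. The bound serves all larger \<open>M\<close>, so that two elements can share one
  power.\<close>

lemma PV_zlaurent_denominator:
  fixes v :: "'n::{finite,linorder} ext"
  assumes "v \<in> PV zlaurent"
  obtains N where "\<And>M. M \<ge> N \<Longrightarrow> pv_scale (zpow M) v \<in> PV zpolys"
proof -
  define K where "K = (\<Union>J. \<Union>m\<in>Poly_Mapping.keys (v J). {k. zcoeff (Poly_Mapping.lookup (v J) m) k \<noteq> 0})"
  have "finite K"
    unfolding K_def using assms by (intro finite_UN_I) (auto simp: PV_def coeffs_in_def zlaurent_def)
  \<comment> \<open>Inserting 0 keeps \<open>Min\<close> meaningful when \<open>K\<close> is empty,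
    that is, for \<open>v = 0\<close>.\<close>
  have "pv_scale (zpow M) v \<in> PV zpolys" if "M \<ge> - Min (insert 0 K)" for M
  proof -
    have "zcoeff (Poly_Mapping.lookup (v J) m) (k - M) = 0" if "k < 0" for J m k
    proof (rule ccontr)
      assume "zcoeff (Poly_Mapping.lookup (v J) m) (k - M) \<noteq> 0"
      then have "k - M \<in> K"
        unfolding K_def by (auto simp: in_keys_iff intro!: exI[of _ J] bexI[of _ m])
      then have "Min (insert 0 K) \<le> k - M"
        using \<open>finite K\<close> by (intro Min_le) auto
      with \<open>k < 0\<close> \<open>M \<ge> - Min (insert 0 K)\<close> show False
        by simp
    qed
    then show ?thesis
      by (simp add: PV_def coeffs_in_def zpolys_def pv_scale_def)
  qed
  with that show ?thesis
    by blast
qed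

lemma of_degree_0D: "of_degree 0 v \<Longrightarrow> J \<noteq> {} \<Longrightarrow> v J = 0" for v :: "'n::finite ext"
  unfolding of_degree_def card_0_eq[OF finite] by metis

context
  fixes f lam :: "'n::{finite,linorder} cpoly" and \<omega> :: "'b::finite \<Rightarrow> 'n zpoly"
    and \<phi> :: "'b \<Rightarrow> 'n cpoly" and \<Phi> :: "'n ext \<Rightarrow> 'n ext"
  assumes triv: "is_trivialization f lam \<omega> \<phi> \<Phi>"
begin

lemma trivialization_zlaurent: "v \<in> PV zlaurent \<Longrightarrow> \<Phi> v \<in> PV zlaurent"
  and trivialization_add:
    "v \<in> PV zlaurent \<Longrightarrow> w \<in> PV zlaurent \<Longrightarrow> \<Phi> (pv_add v w) = pv_add (\<Phi> v) (\<Phi> w)"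
  and trivialization_scale:
    "c \<in> zlaurent \<Longrightarrow> v \<in> PV zlaurent \<Longrightarrow> \<Phi> (pv_scale c v) = pv_scale c (\<Phi> v)"
  and trivialization_bij: "bij_betw \<Phi> (PV zpolys) (PV zpolys)"
  and trivialization_mod_z:
    "v \<in> PV zconst \<Longrightarrow> \<exists>w\<in>PV zpolys. \<Phi> v = pv_add v (pv_scale (zpow 1) w)"
  and trivialization_dbar:
    "v \<in> PV zpolys \<Longrightarrow>
      \<Phi> (pv_dbar f v) = pv_add (pv_dbar f (\<Phi> v)) (pv_scale (zpow 1) (pv_div lam (\<Phi> v)))"
  and trivialization_fun: "v \<in> PV zpolys \<Longrightarrow> of_degree 0 v \<Longrightarrow> of_degree 0 (\<Phi> v)"
  and trivialization_basis: "\<Phi> (pv_fun (emb (\<phi> \<alpha>))) {} - \<omega> \<alpha> \<in> brieskorn_im f"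
  using triv unfolding is_trivialization_def by simp_all

lemma PV_zpolys_zlaurent: "v \<in> PV zpolys \<Longrightarrow> v \<in> PV zlaurent" for v :: "'n ext"
  using PV_mono[OF zpolys_subset_zlaurent] by blast

text \<open>One step of a descent in powers of \<open>z\<close>. With
  \<open>w = w0 + z * w1\<close>, the constant term of \<open>\<Phi> w\<close> in \<open>z\<close>
  is \<open>w0\<close>, so \<open>w0\<close> is a function; then \<open>\<Phi> w0\<close> is one,
  and so is \<open>\<Phi> w1\<close> after division by \<open>z\<close>.\<close>

lemma trivialization_divide_z:
  assumes w: "w \<in> PV zpolys" and deg: "of_degree 0 (\<Phi> w)"
  obtains w' where "w' \<in> PV zpolys" and "of_degree 0 (\<Phi> w')"
    and "\<And>J. J \<noteq> {} \<Longrightarrow> w J = zC (zpow 1) * w' J"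
proof -
  define w0 where "w0 = (\<lambda>J. Poly_Mapping.map (\<lambda>a. fls_const (zcoeff a 0)) (w J))"
  define w1 where "w1 = (\<lambda>J. Poly_Mapping.map (\<lambda>a. zpow (- 1) * (a - fls_const (zcoeff a 0))) (w J))"
  have lookup: "Poly_Mapping.lookup (w0 J) m = fls_const (zcoeff (Poly_Mapping.lookup (w J) m) 0)"
    "Poly_Mapping.lookup (w1 J) m =
      zpow (- 1) * (Poly_Mapping.lookup (w J) m - fls_const (zcoeff (Poly_Mapping.lookup (w J) m) 0))"
    for J m
    by (simp_all add: w0_def w1_def lookup_map)
  have split: "w = pv_add w0 (pv_scale (zpow 1) w1)"
  proof (rule ext)
    fix J show "w J = pv_add w0 (pv_scale (zpow 1) w1) J"
      by (rule poly_mapping_eqI) (simp add: pv_add_def pv_scale_def lookup_add lookup zpow_mult_left)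
  qed
  have w0: "w0 \<in> PV zconst" "w0 \<in> PV zpolys"
    by (auto simp: PV_def coeffs_in_def zconst_def zpolys_def lookup)
  have w1: "w1 \<in> PV zpolys"
    unfolding PV_def coeffs_in_def zpolys_def
  proof (intro CollectI allI impI)
    fix J m and k :: int assume "k < 0"
    then show "zcoeff (Poly_Mapping.lookup (w1 J) m) k = 0"
      using w by (cases "k = - 1") (auto simp: lookup PV_def coeffs_in_def zpolys_def)
  qed
  obtain u where u: "u \<in> PV zpolys" "\<Phi> w0 = pv_add w0 (pv_scale (zpow 1) u)"
    using trivialization_mod_z[OF w0(1)] by blast
  have \<Phi>_w: "\<Phi> w = pv_add (\<Phi> w0) (pv_scale (zpow 1) (\<Phi> w1))"
    using w0(2) w1
    by (subst split) (simp add: trivialization_add trivialization_scale PV_zpolys_zlaurent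
        PV_zlaurent_scale zlaurent_zpow)
  have \<Phi>_w1: "\<Phi> w1 \<in> PV zpolys"
    using bij_betwE[OF trivialization_bij] w1 by blast
  have w0_J: "w0 J = 0" if "J \<noteq> {}" for J
  proof (rule poly_mapping_eqI)
    fix m
    have "w0 J + zC (zpow 1) * (u J + \<Phi> w1 J) = 0"
      using of_degree_0D[OF deg that] by (simp add: \<Phi>_w u(2) pv_add_def pv_scale_def distrib_left add.assoc)
    from arg_cong[OF this, of "\<lambda>p. zcoeff (Poly_Mapping.lookup p m) 0"]
    show "Poly_Mapping.lookup (w0 J) m = Poly_Mapping.lookup 0 m"
      using u(1) \<Phi>_w1 by (simp add: lookup_add lookup PV_def coeffs_in_def zpolys_def)
  qed
  then have "of_degree 0 w0"
    by (auto simp: of_degree_def)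
  then have deg0: "of_degree 0 (\<Phi> w0)"
    by (rule trivialization_fun[OF w0(2)])
  have "\<Phi> w1 J = 0" if "J \<noteq> {}" for J
  proof -
    have "zC (zpow 1) * \<Phi> w1 J = 0"
      using of_degree_0D[OF deg that] of_degree_0D[OF deg0 that] by (simp add: \<Phi>_w pv_add_def pv_scale_def)
    then have "zC (zpow (- 1)) * (zC (zpow 1) * \<Phi> w1 J) = 0"
      by (simp only: mult_zero_right)
    then show ?thesis
      by (simp only: zC_mult_left zpow_mult) simp
  qed
  then have "of_degree 0 (\<Phi> w1)"
    by (auto simp: of_degree_def)
  moreover have "w J = zC (zpow 1) * w1 J" if "J \<noteq> {}" for J
    using fun_cong[OF split, of J] w0_J[OF that] by (simp add: pv_add_def pv_scale_def)
  ultimately show ?thesis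
    using that w1 by blast
qed

text \<open>
  Since \<open>\<Phi> \<equiv> Id\<close> modulo \<open>z\<close> and \<open>\<Phi>\<close> preserves functions, comparing powers of \<open>z\<close> one after the
  other shows that \<open>\<Phi>\<^sup>-\<^sup>1\<close> preserves functions. So the exactness of the Koszul complex is not
  needed to see that \<open>\<Phi>\<^sup>-\<^sup>1\<close> of a function has a class in \<open>Jac(f)\<close>.
\<close>
lemma trivialization_reflects_functions:
  assumes "w \<in> PV zpolys" and "of_degree 0 (\<Phi> w)"
  shows "of_degree 0 w"
proof -
  \<comment> \<open>The induction on the power \<open>n\<close> runs over all such \<open>w\<close>:
    division by \<open>z\<close> lowers the power by one and replaces \<open>w\<close> by another
    element of the same kind.\<close>
  have coeff_0: "zcoeff (Poly_Mapping.lookup (w J) m) (int n) = 0"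
    if "w \<in> PV zpolys" "of_degree 0 (\<Phi> w)" "J \<noteq> {}" for n w J m
    using that
  proof (induction n arbitrary: w)
    case 0
    then obtain w' where "w' \<in> PV zpolys" "w J = zC (zpow 1) * w' J"
      using trivialization_divide_z by metis
    then show ?case
      by (simp add: PV_def coeffs_in_def zpolys_def)
  next
    case (Suc n)
    then obtain w' where "w' \<in> PV zpolys" "of_degree 0 (\<Phi> w')" "w J = zC (zpow 1) * w' J"
      using trivialization_divide_z by metis
    then show ?case
      using Suc.IH[of w'] \<open>J \<noteq> {}\<close> by simp
  qed
  have "w J = 0" if "J \<noteq> {}" for J
  proof (intro poly_mapping_eqI fls_eq_zcoeffI)
    fix m and k :: int
    show "zcoeff (Poly_Mapping.lookup (w J) m) k = zcoeff (Poly_Mapping.lookup 0 m) k"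
    proof (cases "k < 0")
      case True
      with assms(1) show ?thesis
        by (simp add: PV_def coeffs_in_def zpolys_def)
    next
      case False
      with coeff_0[OF assms that, of m "nat k"] show ?thesis
        by simp
    qed
  qed
  then show ?thesis
    by (auto simp: of_degree_def)
qed

text \<open>Bijectivity is given on \<open>PV zpolys\<close>; a common power of \<open>z\<close>
  carries both arguments there. Injectivity lets \<open>inv_into (PV zlaurent) \<Phi>\<close>
  recover any preimage that has been constructed.\<close>

lemma trivialization_inj: "inj_on \<Phi> (PV zlaurent)"
proof (rule inj_onI)
  fix v w assume v: "v \<in> PV zlaurent" and w: "w \<in> PV zlaurent" and eq: "\<Phi> v = \<Phi> w"
  obtain M N where MN: "\<And>i. i \<ge> M \<Longrightarrow> pv_scale (zpow i) v \<in> PV zpolys"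
      "\<And>i. i \<ge> N \<Longrightarrow> pv_scale (zpow i) w \<in> PV zpolys"
    using PV_zlaurent_denominator[OF v] PV_zlaurent_denominator[OF w] by metis
  let ?i = "max M N"
  have "\<Phi> (pv_scale (zpow ?i) v) = \<Phi> (pv_scale (zpow ?i) w)"
    by (simp add: trivialization_scale v w eq zlaurent_zpow)
  then have "pv_scale (zpow ?i) v = pv_scale (zpow ?i) w"
    using bij_betw_imp_inj_on[OF trivialization_bij] MN by (meson inj_onD max.cobounded1 max.cobounded2)
  then show "v = w"
    by (metis pv_scale_zpow_cancel(1))
qed

text \<open>A power of \<open>z\<close> clears the denominators of \<open>g\<close>; the preimage in
  \<open>PV zpolys\<close> is a function by \<open>trivialization_reflects_functions\<close>, and
  linearity removes the power again.\<close>

lemma trivialization_function_preimage: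
  assumes "coeffs_in zlaurent g"
  obtains h where "coeffs_in zlaurent h" and "\<Phi> (pv_fun h) = pv_fun g"
proof -
  have "pv_fun g \<in> PV zlaurent"
    by (simp add: PV_fun assms)
  then obtain M where M: "pv_scale (zpow M) (pv_fun g) \<in> PV zpolys"
    using PV_zlaurent_denominator by blast
  then obtain w where w: "w \<in> PV zpolys" "\<Phi> w = pv_scale (zpow M) (pv_fun g)"
    using bij_betw_imp_surj_on[OF trivialization_bij] by (metis imageE)
  have "of_degree 0 (\<Phi> w)"
    unfolding w(2) pv_scale_fun by (simp add: of_degree_def pv_fun_def)
  then have w_fun: "w = pv_fun (w {})"
    using trivialization_reflects_functions w(1) of_degree_0_iff by blast
  let ?h = "zC (zpow (- M)) * w {}"
  have w_lau: "w \<in> PV zlaurent"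
    using w(1) by (rule PV_zpolys_zlaurent)
  have "\<Phi> (pv_fun ?h) = \<Phi> (pv_scale (zpow (- M)) w)"
    by (subst (2) w_fun) (simp only: pv_scale_fun)
  also have "\<dots> = pv_fun g"
    by (simp add: trivialization_scale w_lau zlaurent_zpow w(2) pv_scale_zpow_cancel)
  finally show ?thesis
    using that[of ?h] w_lau
    by (simp add: PV_def coeffs_in_zlaurent_mult coeffs_in_zlaurent_zC zlaurent_zpow)
qed

section \<open>Images of basis elements and of exact elements\<close>

lemma trivialization_sum:
  assumes "\<And>\<alpha>. c \<alpha> \<in> zlaurent"
  shows "\<Phi> (pv_fun (\<Sum>\<alpha>\<in>A. zC (c \<alpha>) * emb (\<phi> \<alpha>))) {} = (\<Sum>\<alpha>\<in>A. zC (c \<alpha>) * omega_hat \<Phi> \<phi> \<alpha>)"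
proof -
  have pv: "pv_fun (emb p) \<in> PV zlaurent" for p :: "'n cpoly"
    by (simp add: PV_fun coeffs_in_zlaurent_emb)
  have zero: "\<Phi> (pv_fun 0) {} = 0"
    using trivialization_scale[OF zlaurent_0 pv[of 0]] by (simp add: pv_scale_fun) (simp add: pv_scale_def)
  show ?thesis
  proof (induction A rule: infinite_finite_induct)
    case (insert \<beta> A)
    have "pv_fun (\<Sum>\<alpha>\<in>insert \<beta> A. zC (c \<alpha>) * emb (\<phi> \<alpha>)) =
        pv_add (pv_scale (c \<beta>) (pv_fun (emb (\<phi> \<beta>)))) (pv_fun (\<Sum>\<alpha>\<in>A. zC (c \<alpha>) * emb (\<phi> \<alpha>)))"
      using insert.hyps by (simp add: pv_scale_fun pv_add_fun)
    moreover have "pv_fun (\<Sum>\<alpha>\<in>A. zC (c \<alpha>) * emb (\<phi> \<alpha>)) \<in> PV zlaurent"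
      by (intro PV_fun zlaurent_0 coeffs_in_zlaurent_sum coeffs_in_zlaurent_mult coeffs_in_zlaurent_zC
          coeffs_in_zlaurent_emb assms)
    ultimately have "\<Phi> (pv_fun (\<Sum>\<alpha>\<in>insert \<beta> A. zC (c \<alpha>) * emb (\<phi> \<alpha>))) {} =
        zC (c \<beta>) * omega_hat \<Phi> \<phi> \<beta> + \<Phi> (pv_fun (\<Sum>\<alpha>\<in>A. zC (c \<alpha>) * emb (\<phi> \<alpha>))) {}"
      using assms pv by (simp add: trivialization_add trivialization_scale PV_zlaurent_scale)
        (simp add: pv_add_def pv_scale_def omega_hat_def)
    then show ?case
      using insert by simp
  qed (simp_all add: zero)
qed

text \<open>The nowhere vanishing \<open>lam\<close> is a nonzero constant and cancels with its
  inverse, so \<open>pv_div\<close> is the ordinary divergence. This is the form of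
  \<open>brieskorn_im_iff\<close> with \<open>g k = w {k}\<close>.\<close>

lemma dbar_div_in_brieskorn_im:
  assumes "\<forall>x. peval lam x \<noteq> 0"
  shows "pv_dbar f w {} + zC (zpow 1) * pv_div lam w {} \<in> brieskorn_im f"
proof -
  obtain c where c: "c \<noteq> 0" "lam = Poly_Mapping.single 0 c"
    using assms by (rule nowhere_vanishing_imp_const)
  have "poly_inv lam = Poly_Mapping.single 0 (1 / c)"
    unfolding poly_inv_def
  proof (rule the_equality)
    show "lam * Poly_Mapping.single 0 (1 / c) = 1"
      using c by (simp add: mult_single)
    fix g assume "lam * g = 1"
    then have "Poly_Mapping.single 0 (1 / c) * (lam * g) = Poly_Mapping.single 0 (1 / c)"
      by simp
    then show "g = Poly_Mapping.single 0 (1 / c)"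
      using c by (simp add: mult_single flip: mult.assoc)
  qed
  then have emb: "emb lam = zC (fls_const c)" "emb (poly_inv lam) = zC (fls_const (1 / c))"
    by (simp_all add: c emb_single zC_def)
  have "emb lam * pd k (u * emb (poly_inv lam)) = pd k u" for k u
    unfolding emb mult.commute[of u] pd_zC_mult zC_mult_left using c by simp
  then have "pv_div lam w {} = (\<Sum>k\<in>UNIV. pd k (w {k}))"
    by (simp add: pv_div_def)
  then have "pv_dbar f w {} + zC (zpow 1) * pv_div lam w {} =
      (\<Sum>k\<in>UNIV. zC (zpow 1) * pd k (w {k}) + emb (pd k f) * w {k})"
    by (simp add: pv_dbar_empty sum_distrib_left sum.distrib add.commute)
  then show ?thesis
    unfolding brieskorn_im_iff by (rule exI[of _ "\<lambda>k. w {k}"])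
qed

text \<open>The intertwining relation turns \<open>\<Phi>\<close> of an exact element into a value
  of \<open>pv_dbar + z * pv_div\<close>. As the relation is given on \<open>PV zpolys\<close>, a
  power of \<open>z\<close> is inserted and removed.\<close>

lemma trivialization_exact_in_brieskorn_im:
  assumes "\<forall>x. peval lam x \<noteq> 0" and \<eta>: "\<eta> \<in> PV zlaurent"
  shows "\<Phi> (pv_dbar f \<eta>) {} \<in> brieskorn_im f"
proof -
  obtain M where M: "pv_scale (zpow M) \<eta> \<in> PV zpolys"
    using PV_zlaurent_denominator[OF \<eta>] by blast
  have dbar_scale: "pv_dbar f (pv_scale (zpow M) \<eta>) = pv_scale (zpow M) (pv_dbar f \<eta>)"
    by (rule ext) (simp add: pv_dbar_def pv_scale_def sum_distrib_left mult.left_commute)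
  have ext_sign: "coeffs_in zlaurent (ext_sign k I)" for k :: 'n and I
    using zlaurent_const[of 1] zlaurent_const[of "- 1"]
    by (cases "even (card {j\<in>I. j < k})") (auto simp: ext_sign_def coeffs_in_def lookup_one when_def)
  have "pv_dbar f \<eta> \<in> PV zlaurent"
    using \<eta> unfolding PV_def pv_dbar_def
    by (auto intro!: coeffs_in_zlaurent_sum coeffs_in_zlaurent_mult ext_sign coeffs_in_zlaurent_emb)
  then have "zC (zpow M) * \<Phi> (pv_dbar f \<eta>) {} = \<Phi> (pv_dbar f (pv_scale (zpow M) \<eta>)) {}"
    by (simp add: dbar_scale trivialization_scale zlaurent_zpow) (simp add: pv_scale_def)
  also have "\<dots> \<in> brieskorn_im f"
  proof -
    have "pv_add v (pv_scale (zpow 1) w) {} = v {} + zC (zpow 1) * w {}" for v w :: "'n ext"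
      by (simp add: pv_add_def pv_scale_def)
    then show ?thesis
      using dbar_div_in_brieskorn_im[OF assms(1)] by (simp add: trivialization_dbar[OF M])
  qed
  finally have "zC (zpow (- M)) * (zC (zpow M) * \<Phi> (pv_dbar f \<eta>) {}) \<in> brieskorn_im f"
    by (rule brieskorn_im_zC_mult)
  then show ?thesis
    by (simp only: zC_mult_left zpow_mult) simp
qed

text \<open>The same \<open>c\<close> are the coordinates of the preimage of \<open>g\<close> in
  \<open>Jac(f)\<close> and, after \<open>\<Phi>\<close> is applied, those of \<open>g\<close> in
  the basis \<open>\<omega>\<close>. The projection acts on them coordinatewise because
  \<open>\<phi>\<close> and \<open>pd k f\<close> are constant in \<open>z\<close>.\<close>

lemma jac_class_trivialization_inverse:
  assumes lam: "\<forall>x. peval lam x \<noteq> 0" and \<phi>: "jac_basis f \<phi>" and g: "coeffs_in zlaurent g"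
  obtains c where "jac_class f \<phi> (pv_zproj (inv_into (PV zlaurent) \<Phi> (pv_fun g))) = (\<lambda>\<alpha>. zproj (c \<alpha>))"
    and "g - (\<Sum>\<alpha>\<in>UNIV. zC (c \<alpha>) * \<omega> \<alpha>) \<in> brieskorn_im f"
proof -
  obtain h where h: "coeffs_in zlaurent h" "\<Phi> (pv_fun h) = pv_fun g"
    using trivialization_function_preimage[OF g] .
  obtain c u where c: "\<And>\<alpha>. c \<alpha> \<in> zlaurent" and u: "\<And>k. coeffs_in zlaurent (u k)"
    and h_eq: "h = (\<Sum>\<alpha>\<in>UNIV. zC (c \<alpha>) * emb (\<phi> \<alpha>)) + (\<Sum>k\<in>UNIV. emb (pd k f) * u k)"
    by (rule jac_decomposition[OF \<phi> h(1)]) (rule that)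
  \<comment> \<open>The vector field with components \<open>v k\<close>; its \<open>pv_dbar\<close>
    exhibits a Jacobian combination as an exact element.\<close>
  define sing where "sing v J = (\<Sum>k\<in>UNIV. if J = {k} then v k else 0)"
    for v :: "'n \<Rightarrow> 'n zpoly" and J
  have sing_PV: "sing v \<in> PV zlaurent" if "\<And>k. coeffs_in zlaurent (v k)" for v
    using that unfolding PV_def sing_def by (auto intro!: coeffs_in_zlaurent_sum coeffs_in_0)
  have sing_dbar: "pv_dbar f (sing v) = pv_fun (\<Sum>k\<in>UNIV. emb (pd k f) * v k)" for v
  proof (rule ext)
    fix J
    show "pv_dbar f (sing v) J = pv_fun (\<Sum>k\<in>UNIV. emb (pd k f) * v k) J"
    proof (cases "J = {}")
      case True
      have "sing v {k} = v k" for k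
        by (simp add: sing_def)
      with True show ?thesis
        by (simp add: pv_dbar_empty pv_fun_def)
    next
      case False
      have "sing v (insert k J) = 0" if "k \<notin> J" for k
        unfolding sing_def using that False by (auto intro!: sum.neutral split: if_splits)
      with False show ?thesis
        by (simp add: pv_dbar_def pv_fun_def)
    qed
  qed
  have h_fun: "pv_fun h = pv_add (pv_fun (\<Sum>\<alpha>\<in>UNIV. zC (c \<alpha>) * emb (\<phi> \<alpha>))) (pv_dbar f (sing u))"
    by (simp add: sing_dbar pv_add_fun h_eq)
  have "inv_into (PV zlaurent) \<Phi> (pv_fun g) = pv_fun h"
    using inv_into_f_f[OF trivialization_inj PV_fun[OF zlaurent_0 h(1)]] by (simp add: h(2))
  moreover have "jac_class f \<phi> (pv_zproj (pv_fun h)) = (\<lambda>\<alpha>. zproj (c \<alpha>))"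
  proof (rule jac_class_eqI[OF \<phi>])
    have zproj_lau: "zproj a \<in> zlaurent" for a
      using zpolys_subset_zlaurent by (auto simp: zpolys_def)
    then show "zproj (c \<alpha>) \<in> zlaurent" for \<alpha>
      by simp
    show "sing (\<lambda>k. Poly_Mapping.map zproj (u k)) \<in> PV zlaurent"
      by (rule sing_PV) (simp add: coeffs_in_def lookup_map zproj_lau)
    have "Poly_Mapping.map zproj (zC a * emb p) = zC (zproj a) * emb p" for a and p :: "'n cpoly"
      using map_zproj_emb_mult[of p "zC a"] by (simp add: zC_def mult.commute)
    then have "Poly_Mapping.map zproj h = (\<Sum>\<alpha>\<in>UNIV. zC (zproj (c \<alpha>)) * emb (\<phi> \<alpha>))
        + (\<Sum>k\<in>UNIV. emb (pd k f) * Poly_Mapping.map zproj (u k))"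
      by (simp add: h_eq map_add map_sum zproj_add map_zproj_emb_mult)
    moreover have "pv_zproj (pv_fun h) = pv_fun (Poly_Mapping.map zproj h)"
      by (rule ext) (simp add: pv_zproj_def pv_fun_def map_0)
    ultimately show "pv_zproj (pv_fun h) = pv_add (pv_fun (\<Sum>\<alpha>\<in>UNIV. zC (zproj (c \<alpha>)) * emb (\<phi> \<alpha>)))
        (pv_dbar f (sing (\<lambda>k. Poly_Mapping.map zproj (u k))))"
      by (simp add: sing_dbar pv_add_fun)
  qed
  moreover have "g - (\<Sum>\<alpha>\<in>UNIV. zC (c \<alpha>) * \<omega> \<alpha>) \<in> brieskorn_im f"
  proof -
    have lau: "pv_fun (\<Sum>\<alpha>\<in>UNIV. zC (c \<alpha>) * emb (\<phi> \<alpha>)) \<in> PV zlaurent"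
      by (intro PV_fun zlaurent_0 coeffs_in_zlaurent_sum coeffs_in_zlaurent_mult coeffs_in_zlaurent_zC
          coeffs_in_zlaurent_emb c)
    have lau': "pv_dbar f (sing u) \<in> PV zlaurent"
      unfolding sing_dbar
      by (intro PV_fun zlaurent_0 coeffs_in_zlaurent_sum coeffs_in_zlaurent_mult coeffs_in_zlaurent_emb u)
    have "g = \<Phi> (pv_fun h) {}"
      by (simp add: h(2)) (simp add: pv_fun_def)
    also have "\<dots> = (\<Sum>\<alpha>\<in>UNIV. zC (c \<alpha>) * omega_hat \<Phi> \<phi> \<alpha>) + \<Phi> (pv_dbar f (sing u)) {}"
      unfolding h_fun trivialization_add[OF lau lau'] trivialization_sum[OF c, symmetric]
      by (simp only: pv_add_def)
    finally have "g - (\<Sum>\<alpha>\<in>UNIV. zC (c \<alpha>) * \<omega> \<alpha>) =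
        \<Phi> (pv_dbar f (sing u)) {} + (\<Sum>\<alpha>\<in>UNIV. zC (c \<alpha>) * (omega_hat \<Phi> \<phi> \<alpha> - \<omega> \<alpha>))"
      by (simp add: algebra_simps sum_subtractf)
    also have "\<dots> \<in> brieskorn_im f"
      using trivialization_basis sing_PV[OF u]
      by (intro brieskorn_im_add brieskorn_im_sum brieskorn_im_zC_mult
          trivialization_exact_in_brieskorn_im[OF lam]) (simp_all add: omega_hat_def)
    finally show ?thesis .
  qed
  ultimately show ?thesis
    using that by metis
qed

end


subsection \<open>Degrees in s\<close>

lemma finite_bounded_exponents: "finite {s :: 'b::finite \<Rightarrow>\<^sub>0 nat. \<forall>\<alpha>. Poly_Mapping.lookup s \<alpha> \<le> N \<alpha>}"
proof (rule finite_imageD)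
  show "inj_on Poly_Mapping.lookup {s :: 'b \<Rightarrow>\<^sub>0 nat. \<forall>\<alpha>. Poly_Mapping.lookup s \<alpha> \<le> N \<alpha>}"
    by (rule inj_onI) (rule poly_mapping_eqI, simp)
  have "Poly_Mapping.lookup ` {s :: 'b \<Rightarrow>\<^sub>0 nat. \<forall>\<alpha>. Poly_Mapping.lookup s \<alpha> \<le> N \<alpha>} \<subseteq> PiE UNIV (\<lambda>\<alpha>. {..N \<alpha>})"
    by auto
  then show "finite (Poly_Mapping.lookup ` {s :: 'b \<Rightarrow>\<^sub>0 nat. \<forall>\<alpha>. Poly_Mapping.lookup s \<alpha> \<le> N \<alpha>})"
    by (rule finite_subset) (simp add: finite_PiE)
qed

lemma finite_antidiagonal: "finite {(t1, t2). t1 + t2 = (t :: 'b::finite \<Rightarrow>\<^sub>0 nat)}"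
proof -
  let ?A = "{s :: 'b \<Rightarrow>\<^sub>0 nat. \<forall>\<alpha>. Poly_Mapping.lookup s \<alpha> \<le> Poly_Mapping.lookup t \<alpha>}"
  have "finite ?A"
    by (rule finite_bounded_exponents)
  moreover have "{(t1, t2). t1 + t2 = t} \<subseteq> ?A \<times> ?A"
    by (auto simp: lookup_add)
  ultimately show ?thesis
    by (meson finite_SigmaI finite_subset)
qed

lemma lookup_mult_antidiagonal:
  fixes u v :: "('b::finite \<Rightarrow>\<^sub>0 nat) \<Rightarrow>\<^sub>0 'a::comm_semiring_1"
  shows "Poly_Mapping.lookup (u * v) t =
    (\<Sum>(t1, t2)\<in>{(t1, t2). t1 + t2 = t}. Poly_Mapping.lookup u t1 * Poly_Mapping.lookup v t2)"
proof (induction u rule: poly_mapping_additive_induct)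
  case (single a x)
  show ?case
  proof (induction v rule: poly_mapping_additive_induct)
    case (single b y)
    have "(\<Sum>(t1, t2)\<in>{(t1, t2). t1 + t2 = t}. Poly_Mapping.lookup (Poly_Mapping.single a x) t1
        * Poly_Mapping.lookup (Poly_Mapping.single b y) t2) =
      (\<Sum>p\<in>{(t1, t2). t1 + t2 = t}. if (a, b) = p then x * y else 0)"
      by (rule sum.cong) (auto simp: lookup_single when_def split: if_splits)
    then show ?case
      using finite_antidiagonal[of t] by (simp add: sum.delta mult_single lookup_single when_def)
  qed (simp_all add: distrib_left lookup_add case_prod_unfold sum.distrib)
qed (simp_all add: distrib_right lookup_add case_prod_unfold sum.distrib)

lemma lookup_single_0_mult:
  fixes u :: "('b \<Rightarrow>\<^sub>0 nat) \<Rightarrow>\<^sub>0 'a::comm_semiring_1"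
  shows "Poly_Mapping.lookup (Poly_Mapping.single 0 c * u) t = c * Poly_Mapping.lookup u t"
  by (simp add: lookup_map flip: mult_map_scale_conv_mult)

lemma sdeg_0 [simp]: "sdeg 0 = 0"
  by (simp add: sdeg_def)

lemma sdeg_add: "sdeg (s + t) = sdeg s + sdeg t"
  by (simp add: sdeg_def lookup_add sum.distrib)

lemma sdeg_single: "sdeg (Poly_Mapping.single \<alpha> n) = n"
  by (simp add: sdeg_def lookup_single when_def)

lemma finite_sdeg_eq: "finite {t :: 'b::finite \<Rightarrow>\<^sub>0 nat. sdeg t = p}"
proof (rule finite_subset[OF _ finite_bounded_exponents[of "\<lambda>_. p"]])
  show "{t :: 'b \<Rightarrow>\<^sub>0 nat. sdeg t = p} \<subseteq> {s. \<forall>\<alpha>. Poly_Mapping.lookup s \<alpha> \<le> p}"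
    by (auto simp: sdeg_def intro: member_le_sum)
qed

text \<open>Only finitely many exponents have degree \<open>p\<close>, so the function under
  \<open>Abs_poly_mapping\<close> has finite support.\<close>

lemma lookup_spart: "Poly_Mapping.lookup (spart p d) t = (if sdeg t = p then d t else 0)"
proof -
  have "finite {t. (if sdeg t = p then d t else 0) \<noteq> 0}"
    by (rule finite_subset[OF _ finite_sdeg_eq[of p]]) auto
  then show ?thesis
    by (simp add: spart_def)
qed

section \<open>Homogeneity in \<open>s\<close> of the terms of the recursion\<close>

lemma lookup_zeta_part:
  "Poly_Mapping.lookup (zeta_part rep \<zeta> p) t =
     (if sdeg t = p then \<Sum>\<alpha>\<in>UNIV. zC (\<zeta> \<alpha> t) * rep \<alpha> else 0)"
  by (simp add: zeta_part_def lookup_sum mult.commute[of _ "Poly_Mapping.single 0 _"]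
      lookup_single_0_mult lookup_map lookup_spart mult.commute)

lemma unfold_diff_eq:
  "unfold_diff f \<phi> = (\<Sum>\<alpha>\<in>UNIV. Poly_Mapping.single (Poly_Mapping.single \<alpha> 1) (emb (\<phi> \<alpha>)))"
  by (simp add: unfold_diff_def unfold_poly_def)

text \<open>\<open>F - f\<close> is linear in \<open>s\<close>, so degrees add up to
  \<open>k\<close> in its power.\<close>

lemma sdeg_unfold_diff_power:
  assumes "t \<in> Poly_Mapping.keys (unfold_diff f \<phi> ^ k)"
  shows "sdeg t = k"
  using assms
proof (induction k arbitrary: t)
  case (Suc k)
  then obtain t1 t2 where t: "t = t1 + t2" "t1 \<in> Poly_Mapping.keys (unfold_diff f \<phi>)"
      "t2 \<in> Poly_Mapping.keys (unfold_diff f \<phi> ^ k)"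
    using keys_mult[of "unfold_diff f \<phi>" "unfold_diff f \<phi> ^ k"] by auto
  have "sdeg t1 = 1"
  proof (rule ccontr)
    assume "sdeg t1 \<noteq> 1"
    then have "Poly_Mapping.single \<alpha> 1 \<noteq> t1" for \<alpha>
      by (auto simp: sdeg_single)
    then have "Poly_Mapping.lookup (unfold_diff f \<phi>) t1 = 0"
      unfolding unfold_diff_eq lookup_sum by (simp add: lookup_single when_def)
    with t(2) show False
      by (simp add: in_keys_iff)
  qed
  with Suc.IH[OF t(3)] show ?case
    by (simp add: t(1) sdeg_add)
qed simp

lemma coeffs_in_unfold_diff_power:
  "coeffs_in zlaurent (Poly_Mapping.lookup (unfold_diff f \<phi> ^ k) t)"
proof (induction k arbitrary: t)
  case 0
  show ?case
    using zlaurent_const[of 1]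
    by (auto simp: lookup_one when_def coeffs_in_def)
next
  case (Suc k)
  have "coeffs_in zlaurent (Poly_Mapping.lookup (unfold_diff f \<phi>) s)" for s
    unfolding unfold_diff_eq lookup_sum
    by (intro coeffs_in_zlaurent_sum) (auto simp: lookup_single when_def coeffs_in_zlaurent_emb coeffs_in_0)
  with Suc show ?case
    by (auto simp: lookup_mult_antidiagonal intro!: coeffs_in_zlaurent_sum coeffs_in_zlaurent_mult)
qed

text \<open>Every term has degree \<open>a + (p - a) = p\<close> in \<open>s\<close>.\<close>

lemma lookup_recursion_sum_eq_0:
  assumes "sdeg t \<noteq> p"
  shows "Poly_Mapping.lookup (recursion_sum f \<phi> rep \<zeta> p) t = 0"
proof -
  have "Poly_Mapping.lookup (unfold_diff f \<phi> ^ a * zeta_part rep \<zeta> (p - a)) t = 0" if "a \<in> {1..p}" for a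
  proof (rule ccontr)
    assume "Poly_Mapping.lookup (unfold_diff f \<phi> ^ a * zeta_part rep \<zeta> (p - a)) t \<noteq> 0"
    then obtain t1 t2 where t: "t = t1 + t2" "t1 \<in> Poly_Mapping.keys (unfold_diff f \<phi> ^ a)"
        "t2 \<in> Poly_Mapping.keys (zeta_part rep \<zeta> (p - a))"
      using keys_mult[of "unfold_diff f \<phi> ^ a" "zeta_part rep \<zeta> (p - a)"] by (force simp: in_keys_iff)
    have "sdeg t1 = a"
      using t(2) by (rule sdeg_unfold_diff_power)
    moreover have "sdeg t2 = p - a"
      using t(3) by (auto simp: in_keys_iff lookup_zeta_part split: if_splits)
    ultimately show False
      using assms that t(1) by (simp add: sdeg_add)
  qed
  then show ?thesis
    by (simp add: recursion_sum_def lookup_sum mult.assoc lookup_single_0_mult)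
qed

text \<open>The term \<open>k = 0\<close> of the exponential is the series itself. For
  \<open>k = a \<ge> 1\<close> the factor \<open>(F - f)^a\<close> uses up degree \<open>a\<close>,
  so only the part of the series of degree \<open>p - a\<close> contributes, as in the
  recursion.\<close>

lemma exp_unfold_eq:
  assumes "sdeg t = p"
  shows "exp_unfold f \<phi> (\<lambda>t. \<Sum>\<alpha>\<in>UNIV. zC (\<zeta> \<alpha> t) * rep \<alpha>) t =
    (\<Sum>\<alpha>\<in>UNIV. zC (\<zeta> \<alpha> t) * rep \<alpha>) + Poly_Mapping.lookup (recursion_sum f \<phi> rep \<zeta> p) t"
proof -
  let ?S = "\<lambda>t. \<Sum>\<alpha>\<in>UNIV. zC (\<zeta> \<alpha> t) * rep \<alpha>" and ?D = "{(t1, t2). t1 + t2 = t}"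
  let ?c = "\<lambda>k. zC (fls_const (1 / fact k) * zpow (- int k))"
  let ?T = "\<lambda>k. \<Sum>(t1, t2)\<in>?D. ?c k * Poly_Mapping.lookup (unfold_diff f \<phi> ^ k) t1 * ?S t2"
  have "?T 0 = (\<Sum>x\<in>?D. if (0, t) = x then ?S t else 0)"
    by (rule sum.cong) (auto simp: lookup_one when_def split: if_splits)
  then have T0: "?T 0 = ?S t"
    using finite_antidiagonal[of t] by (simp add: sum.delta)
  have T: "?T a = Poly_Mapping.lookup (Poly_Mapping.single 0 (?c a) * unfold_diff f \<phi> ^ a * zeta_part rep \<zeta> (p - a)) t"
    if "a \<in> {1..p}" for a
  proof -
    have "?T a = (\<Sum>(t1, t2)\<in>?D. ?c a * (Poly_Mapping.lookup (unfold_diff f \<phi> ^ a) t1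
        * Poly_Mapping.lookup (zeta_part rep \<zeta> (p - a)) t2))"
    proof (rule sum.cong[OF refl], clarify)
      fix t1 t2 assume t: "t = t1 + t2"
      show "?c a * Poly_Mapping.lookup (unfold_diff f \<phi> ^ a) t1 * ?S t2 =
          ?c a * (Poly_Mapping.lookup (unfold_diff f \<phi> ^ a) t1 * Poly_Mapping.lookup (zeta_part rep \<zeta> (p - a)) t2)"
      proof (cases "Poly_Mapping.lookup (unfold_diff f \<phi> ^ a) t1 = 0")
        case False
        then have "sdeg t1 = a"
          by (intro sdeg_unfold_diff_power) (simp add: in_keys_iff)
        then have "sdeg t2 = p - a"
          using assms t by (simp add: sdeg_add)
        then show ?thesis
          by (simp add: lookup_zeta_part mult.assoc)
      qed simp
    qed
    then show ?thesis
      unfolding mult.assoc lookup_single_0_mult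
      unfolding lookup_mult_antidiagonal by (simp add: sum_distrib_left case_prod_unfold)
  qed
  have "exp_unfold f \<phi> ?S t = (\<Sum>k\<le>p. ?T k)"
    by (simp add: exp_unfold_def assms)
  also have "\<dots> = ?T 0 + (\<Sum>a=1..p. ?T a)"
    by (simp add: sum.atLeast_Suc_atMost atMost_atLeast0)
  also have "(\<Sum>a=1..p. ?T a) = Poly_Mapping.lookup (recursion_sum f \<phi> rep \<zeta> p) t"
    unfolding recursion_sum_def lookup_sum by (rule sum.cong[OF refl]) (rule T)
  finally show ?thesis
    unfolding T0 .
qed

lemma coeffs_in_recursion_sum:
  assumes rep: "\<And>\<alpha>. coeffs_in zlaurent (rep \<alpha>)" and \<zeta>: "\<And>\<alpha> t. \<zeta> \<alpha> t \<in> zlaurent"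
  shows "coeffs_in zlaurent (Poly_Mapping.lookup (recursion_sum f \<phi> rep \<zeta> p) t)"
proof -
  have "coeffs_in zlaurent (Poly_Mapping.lookup (zeta_part rep \<zeta> k) s)" for k s
    using assms
    by (auto simp: lookup_zeta_part coeffs_in_0
        intro!: coeffs_in_zlaurent_sum coeffs_in_zlaurent_mult coeffs_in_zlaurent_zC)
  then show ?thesis
    unfolding recursion_sum_def lookup_sum mult.assoc lookup_single_0_mult
    unfolding lookup_mult_antidiagonal
    by (auto intro!: coeffs_in_zlaurent_sum coeffs_in_zlaurent_mult coeffs_in_zlaurent_zC
        zlaurent_const_mult zlaurent_zpow coeffs_in_unfold_diff_power)
qed


section \<open>Comparison of coordinates at each monomial in \<open>s\<close>\<close>

theorem theorem7p2:
  fixes f lam :: "'n::{finite,linorder} cpoly"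
    and q :: "'n \<Rightarrow> rat"
    and L :: "'n zpoly set"
    and \<omega> :: "'b::finite \<Rightarrow> 'n zpoly"
    and \<phi> :: "'b \<Rightarrow> 'n cpoly"
    and \<Phi> :: "'n ext \<Rightarrow> 'n ext"
    and \<zeta> :: "'b \<Rightarrow> ('b \<Rightarrow>\<^sub>0 nat) \<Rightarrow> complex fls"
    and p :: nat
  assumes "quasihomogeneous q f" and "isolated_singularity f"
    and "\<forall>x. peval lam x \<noteq> 0"
    and "good_opposite q f L"
    and "good_basis q f L \<omega>"
    and "leading_polys q f \<omega> \<phi>"
    and "is_trivialization f lam \<omega> \<phi> \<Phi>"
    and "is_primitive_form f \<omega> \<phi> (omega_hat \<Phi> \<phi>) \<zeta>"
    and "p \<ge> 1"
  shows "\<forall>\<alpha> t. Poly_Mapping.lookup (spart p (\<zeta> \<alpha>)) t =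
    - jac_class f \<phi> (pv_zproj (inv_into (PV zlaurent) \<Phi>
        (pv_fun (Poly_Mapping.lookup (recursion_sum f \<phi> (omega_hat \<Phi> \<phi>) \<zeta> p) t)))) \<alpha>"
proof (intro allI)
  fix \<alpha> :: 'b and t :: "'b \<Rightarrow>\<^sub>0 nat"
  note triv = assms(7)
  let ?rep = "omega_hat \<Phi> \<phi>"
  let ?G = "Poly_Mapping.lookup (recursion_sum f \<phi> ?rep \<zeta> p) t"
  have \<phi>: "jac_basis f \<phi>"
    using assms(6) by (simp add: leading_polys_def)
  have \<zeta>: "\<zeta> \<beta> s \<in> zpolys" for \<beta> s
    using assms(8) by (simp add: is_primitive_form_def)
  have rep: "coeffs_in zlaurent (?rep \<beta>)" for \<beta>
    using trivialization_zlaurent[OF triv, of "pv_fun (emb (\<phi> \<beta>))"]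
    by (simp add: omega_hat_def PV_fun coeffs_in_zlaurent_emb) (simp add: PV_def)
  have "coeffs_in zlaurent ?G"
    using rep \<zeta> zpolys_subset_zlaurent by (intro coeffs_in_recursion_sum) auto
  then obtain c where
    coords: "jac_class f \<phi> (pv_zproj (inv_into (PV zlaurent) \<Phi> (pv_fun ?G))) = (\<lambda>\<alpha>. zproj (c \<alpha>))"
    and c: "?G - (\<Sum>\<beta>\<in>UNIV. zC (c \<beta>) * \<omega> \<beta>) \<in> brieskorn_im f"
    by (rule jac_class_trivialization_inverse[OF triv assms(3) \<phi>])
  \<comment> \<open>Independence over the whole field of Laurent series is used: \<open>d\<close>
    may have infinitely many negative powers of \<open>z\<close>, as the coordinates of
    \<open>J\<close> may.\<close>
  have coord: "c \<beta> = d \<beta>" if "?G - (\<Sum>\<beta>\<in>UNIV. zC (d \<beta>) * \<omega> \<beta>) \<in> brieskorn_im f" for d \<beta>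
  proof -
    have "(\<Sum>\<beta>\<in>UNIV. zC (c \<beta> - d \<beta>) * \<omega> \<beta>) \<in> brieskorn_im f"
      using brieskorn_im_diff[OF that c] by (simp add: zC_diff left_diff_distrib sum_subtractf)
    from good_basis_independent[OF assms(1,4,5) this] show ?thesis
      by simp
  qed
  have "zproj (c \<alpha>) = (if sdeg t = p then - \<zeta> \<alpha> t else 0)"
  proof (cases "sdeg t = p")
    case False
    then have "c \<alpha> = 0"
      by (intro coord) (simp add: lookup_recursion_sum_eq_0)
    with False show ?thesis
      by simp
  next
    case True
    \<comment> \<open>The class of the volume form enters \<open>J\<close> only at
      \<open>t = 0\<close>, which \<open>p \<ge> 1\<close> excludes.\<close>
    with assms(9) have "t \<noteq> 0"
      by auto
    then have "\<exists>j. (\<forall>\<beta>. j \<beta> \<in> zneg) \<and>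
        exp_unfold f \<phi> (\<lambda>t. \<Sum>\<beta>\<in>UNIV. zC (\<zeta> \<beta> t) * ?rep \<beta>) t - (\<Sum>\<beta>\<in>UNIV. zC (j \<beta>) * \<omega> \<beta>) \<in> brieskorn_im f"
      using assms(8) unfolding is_primitive_form_def by (elim conjE allE[of _ t]) simp
    then obtain j where j: "\<forall>\<beta>. j \<beta> \<in> zneg"
      and J: "exp_unfold f \<phi> (\<lambda>t. \<Sum>\<beta>\<in>UNIV. zC (\<zeta> \<beta> t) * ?rep \<beta>) t - (\<Sum>\<beta>\<in>UNIV. zC (j \<beta>) * \<omega> \<beta>) \<in> brieskorn_im f"
      by (elim exE conjE) (rule that)
    \<comment> \<open>In the term of order 0 of the exponential the representatives are multiplied
      by scalars only, so there they may be replaced by \<open>\<omega>\<close> modulo the image;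
      inside \<open>?G\<close> they stay.\<close>
    have "(\<Sum>\<beta>\<in>UNIV. zC (\<zeta> \<beta> t) * (?rep \<beta> - \<omega> \<beta>)) \<in> brieskorn_im f"
      using trivialization_basis[OF triv]
      by (intro brieskorn_im_sum brieskorn_im_zC_mult) (simp add: omega_hat_def)
    from brieskorn_im_diff[OF J this]
    have "?G - (\<Sum>\<beta>\<in>UNIV. zC (j \<beta> - \<zeta> \<beta> t) * \<omega> \<beta>) \<in> brieskorn_im f"
      unfolding exp_unfold_eq[OF True] by (simp add: zC_diff algebra_simps sum_subtractf)
    then have "c \<alpha> = j \<alpha> - \<zeta> \<alpha> t"
      by (rule coord)
    with True show ?thesis
      by (simp add: zproj_diff zproj_zneg j zproj_zpolys \<zeta>)
  qed
  then show "Poly_Mapping.lookup (spart p (\<zeta> \<alpha>)) t =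
      - jac_class f \<phi> (pv_zproj (inv_into (PV zlaurent) \<Phi> (pv_fun ?G))) \<alpha>"
    by (simp add: lookup_spart coords)
qed

end
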